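(* For every integer $n>2$, the number of pairs $(s,t)\in S_n\times S_n$ whose commutator $[s,t]=sts^{-1}t^{-1}$ is a $3$-cycle equals $$\#\mathcal{B}(n)=\frac{3}{8}\left(\sum_{k=1}^{n}\sigma_3(k)P(n-k)-2\sum_{k=1}^{n}k\,\sigma_1(k)P(n-k)+nP(n)\right)n!.$$
   Context: $\sigma_\ell(k)=\sum_{d\mid k}d^\ell$ is the sum of the $\ell$-th powers of the positive divisors of $k$. $P(m)$ is the number of partitions of $m$ (unordered sums of positive integers equal to $m$), with $P(0)=1$. Permutations compose as functions. *)

theory Defs
  imports "HOL-Combinatorics.Combinatorics" "HOL-Library.Multiset"
begin

definition divisor_sigma :: "nat \<Rightarrow> nat \<Rightarrow> nat" where
  "divisor_sigma l k = (\<Sum>d \<in> {d. d dvd k \<and> d > 0}. d ^ l)"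

definition partition_count :: "nat \<Rightarrow> nat" where
  "partition_count m = card {M :: nat multiset. (\<forall>x \<in># M. x > 0) \<and> sum_mset M = m}"

definition is_3cycle :: "(nat \<Rightarrow> nat) \<Rightarrow> bool" where
  "is_3cycle p \<longleftrightarrow> (\<exists>a b c. distinct [a, b, c] \<and> p = cycle_of_list [a, b, c])"

definition perm_commutator :: "(nat \<Rightarrow> nat) \<Rightarrow> (nat \<Rightarrow> nat) \<Rightarrow> nat \<Rightarrow> nat" where
  "perm_commutator s t = s \<circ> t \<circ> inv s \<circ> inv t"

end

theory Submission
  imports Defs
begin

text \<open>The commutator of \<open>s\<close> and \<open>t\<close> equals \<open>c\<close> iff \<open>t s t\<^sup>-\<^sup>1 = c\<^sup>-\<^sup>1 s\<close>, so by orbit-stabiliser the count is \<open>n!\<close>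
  times the sum, over all cycle types \<open>\<lambda>\<close> of size \<open>n\<close>, of the number of 3-cycles \<open>c\<close> for which \<open>c s\<close> is again
  of type \<open>\<lambda>\<close>, where \<open>s\<close> has type \<open>\<lambda>\<close>. Writing \<open>c\<close> as a product of two transpositions, these must merge two
  cycles and split one cycle, in either order, and this number is the sum of \<open>k(k-1)(k-2)/6\<close> over
  the cycles plus the sum of \<open>k l\<close> over the pairs of cycles of lengths \<open>k > l\<close>. Summing over \<open>\<lambda>\<close>, the
  coefficient of \<open>P(n-m)\<close> involves divisor sums of \<open>m\<close> and the sum of \<open>a b\<close> over the solutions of
  \<open>a x + b y = m\<close> with \<open>a > b\<close>; the latter is evaluated with the Euclidean bijection
  \<open>(a, b, x, y) \<mapsto> (a - b, b, x, x + y)\<close> from \<open>{a > b}\<close> onto \<open>{x < y}\<close>. The terms in \<open>\<sigma>\<^sub>2\<close> cancel.\<close>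

section \<open>A divisor sum convolution\<close>

text \<open>The entries \<open>a\<close> and \<open>b\<close> will be part sizes, \<open>x\<close>
  and \<open>y\<close> their multiplicities. Summing \<open>a * b\<close> over the whole set gives
  the convolution square of \<open>divisor_sigma 1\<close> at \<open>m\<close>.\<close>

definition bilinear_reps :: "nat \<Rightarrow> (nat \<times> nat \<times> nat \<times> nat) set" where
  "bilinear_reps m = {(a, b, x, y). 0 < a \<and> 0 < b \<and> 0 < x \<and> 0 < y \<and> a * x + b * y = m}"

lemma finite_bilinear_reps: "finite (bilinear_reps m)"
proof (rule finite_subset)
  show "bilinear_reps m \<subseteq> {..m} \<times> {..m} \<times> {..m} \<times> {..m}"
  proof
    fix q assume "q \<in> bilinear_reps m"
    then obtain a b x y where h: "q = (a, b, x, y)" "0 < a" "0 < b" "0 < x" "0 < y" "a * x + b * y = m"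
      by (auto simp: bilinear_reps_def)
    have "a \<le> a * x" "x \<le> a * x" "b \<le> b * y" "y \<le> b * y" using h by simp_all
    hence "a \<le> m" "x \<le> m" "b \<le> m" "y \<le> m" using h(6) by linarith+
    thus "q \<in> {..m} \<times> {..m} \<times> {..m} \<times> {..m}" using h(1) by simp
  qed
qed simp

lemma sum_bilinear_reps_swap:
  fixes Q :: "nat \<Rightarrow> nat \<Rightarrow> 'a::comm_monoid_add"
  shows "(\<Sum>(a,b,x,y) | (a,b,x,y) \<in> bilinear_reps m \<and> a < b. Q a b)
       = (\<Sum>(a,b,x,y) | (a,b,x,y) \<in> bilinear_reps m \<and> b < a. Q b a)"
    and "(\<Sum>(a,b,x,y) | (a,b,x,y) \<in> bilinear_reps m \<and> y < x. Q a b)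
       = (\<Sum>(a,b,x,y) | (a,b,x,y) \<in> bilinear_reps m \<and> x < y. Q b a)"
  by (rule sum.reindex_bij_witness[where i = "\<lambda>(a,b,x,y). (b,a,y,x)" and j = "\<lambda>(a,b,x,y). (b,a,y,x)"],
      auto simp: bilinear_reps_def add.commute)+

text \<open>One Euclidean step: a x + b y = (a - b) x + b (x + y). Subtracting in the coefficients
  is adding in the multipliers, so b < a, which keeps a - b positive, is traded for x < x +
  y.\<close>

lemma sum_bilinear_reps_euclid:
  fixes Q :: "nat \<Rightarrow> nat \<Rightarrow> 'a::comm_monoid_add"
  shows "(\<Sum>(a,b,x,y) | (a,b,x,y) \<in> bilinear_reps m \<and> b < a. Q a b)
       = (\<Sum>(a,b,x,y) | (a,b,x,y) \<in> bilinear_reps m \<and> x < y. Q (a + b) b)"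
proof (rule sum.reindex_bij_witness[where i = "\<lambda>(a,b,x,y). (a+b,b,x,y-x)"
      and j = "\<lambda>(a,b,x,y). (a-b,b,x,x+y)"])
  fix q assume "q \<in> {(a,b,x,y). (a,b,x,y) \<in> bilinear_reps m \<and> b < a}"
  then obtain a b x y where q: "q = (a,b,x,y)" "b < a" "(a,b,x,y) \<in> bilinear_reps m" by auto
  have "(a - b) * x + b * x = a * x"
    using q(2) by (simp flip: distrib_right)
  hence "(a - b) * x + b * (x + y) = a * x + b * y"
    by (simp add: distrib_left)
  thus "(case q of (a,b,x,y) \<Rightarrow> (a-b,b,x,x+y)) \<in> {(a,b,x,y). (a,b,x,y) \<in> bilinear_reps m \<and> x < y}"
    using q by (auto simp: bilinear_reps_def)
next
  fix q assume "q \<in> {(a,b,x,y). (a,b,x,y) \<in> bilinear_reps m \<and> x < y}"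
  then obtain a b x y where q: "q = (a,b,x,y)" "x < y" "(a,b,x,y) \<in> bilinear_reps m" by auto
  have "b * x \<le> b * y" using q by simp
  hence "(a + b) * x + b * (y - x) = a * x + b * y"
    by (simp add: algebra_simps diff_mult_distrib2)
  thus "(case q of (a,b,x,y) \<Rightarrow> (a+b,b,x,y-x)) \<in> {(a,b,x,y). (a,b,x,y) \<in> bilinear_reps m \<and> b < a}"
    using q by (auto simp: bilinear_reps_def)
qed auto

text \<open>The same total is cut once by comparing the coefficients and once by comparing the
  multipliers. Exchanging the two summands a x and b y folds one half of each cut onto the other,
  with the arguments of \<open>Q\<close> exchanged.\<close>

lemma sum_bilinear_reps_trichotomy:
  fixes Q :: "nat \<Rightarrow> nat \<Rightarrow> 'a::comm_monoid_add"
  shows "(\<Sum>(a,b,x,y)\<in>bilinear_reps m. Q a b)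
       = (\<Sum>(a,b,x,y) | (a,b,x,y) \<in> bilinear_reps m \<and> b < a. Q a b)
       + (\<Sum>(a,b,x,y) | (a,b,x,y) \<in> bilinear_reps m \<and> b < a. Q b a)
       + (\<Sum>(a,b,x,y) | (a,b,x,y) \<in> bilinear_reps m \<and> a = b. Q a b)" (is ?thesis1)
    and "(\<Sum>(a,b,x,y)\<in>bilinear_reps m. Q a b)
       = (\<Sum>(a,b,x,y) | (a,b,x,y) \<in> bilinear_reps m \<and> x < y. Q a b)
       + (\<Sum>(a,b,x,y) | (a,b,x,y) \<in> bilinear_reps m \<and> x < y. Q b a)
       + (\<Sum>(a,b,x,y) | (a,b,x,y) \<in> bilinear_reps m \<and> x = y. Q a b)" (is ?thesis2)
proof -
  let ?f = "\<lambda>(a,b,x,y). Q a b"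
  have split: "sum ?f (bilinear_reps m) = sum ?f {q \<in> bilinear_reps m. P q}
      + sum ?f {q \<in> bilinear_reps m. R q} + sum ?f {q \<in> bilinear_reps m. T q}"
    if "\<And>q. P q \<or> R q \<or> T q" "\<And>q. \<not> (P q \<and> R q)" "\<And>q. \<not> (P q \<and> T q)" "\<And>q. \<not> (R q \<and> T q)"
    for P R T
  proof -
    have "bilinear_reps m = {q \<in> bilinear_reps m. P q} \<union> {q \<in> bilinear_reps m. R q} \<union> {q \<in> bilinear_reps m. T q}"
      using that(1) by blast
    also have "sum ?f \<dots> = sum ?f ({q \<in> bilinear_reps m. P q} \<union> {q \<in> bilinear_reps m. R q})
        + sum ?f {q \<in> bilinear_reps m. T q}"
      by (rule sum.union_disjoint) (use that in \<open>auto simp: finite_bilinear_reps\<close>)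
    also have "sum ?f ({q \<in> bilinear_reps m. P q} \<union> {q \<in> bilinear_reps m. R q}) =
       sum ?f {q \<in> bilinear_reps m. P q} + sum ?f {q \<in> bilinear_reps m. R q}"
      by (rule sum.union_disjoint) (use that in \<open>auto simp: finite_bilinear_reps\<close>)
    finally show ?thesis .
  qed
  have set: "{q \<in> bilinear_reps m. case q of (a,b,x,y) \<Rightarrow> P a b x y}
      = {(a,b,x,y). (a,b,x,y) \<in> bilinear_reps m \<and> P a b x y}" for P by auto
  show ?thesis1
    using split[of "\<lambda>(a,b,x,y). b < a" "\<lambda>(a,b,x,y). a < b" "\<lambda>(a,b,x,y). a = b"]
    unfolding set sum_bilinear_reps_swap(1) by fastforce
  show ?thesis2
    using split[of "\<lambda>(a,b,x,y). x < y" "\<lambda>(a,b,x,y). y < x" "\<lambda>(a,b,x,y). x = y"]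
    unfolding set sum_bilinear_reps_swap(2) by fastforce
qed

text \<open>With a = b = d the equation reads d (x + y) = m, so d divides m and x runs over the m/d
  - 1 values that leave y positive.\<close>

lemma sum_bilinear_reps_fst_diagonal:
  fixes Q :: "nat \<Rightarrow> nat \<Rightarrow> real"
  assumes "m > 0"
  shows "(\<Sum>(a,b,x,y) | (a,b,x,y) \<in> bilinear_reps m \<and> a = b. Q a b)
       = (\<Sum>d | d dvd m \<and> d > 0. real (m div d - 1) * Q d d)"
proof -
  have "(\<Sum>(a,b,x,y) | (a,b,x,y) \<in> bilinear_reps m \<and> a = b. Q a b)
      = (\<Sum>(d,x)\<in>(SIGMA d:{d. d dvd m \<and> d > 0}. {1..<m div d}). Q d d)"
  proof (rule sum.reindex_bij_witness[where i = "\<lambda>(d,x). (d,d,x,m div d - x)"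
        and j = "\<lambda>(a,b,x,y). (a,x)"])
    fix q assume "q \<in> {(a,b,x,y). (a,b,x,y) \<in> bilinear_reps m \<and> a = b}"
    then obtain a x y where q: "q = (a,a,x,y)" "a > 0" "x > 0" "y > 0" "m = a * (x + y)"
      by (auto simp: bilinear_reps_def algebra_simps)
    hence "m div a = x + y" by simp
    thus "(case case q of (a,b,x,y) \<Rightarrow> (a,x) of (d,x) \<Rightarrow> (d,d,x,m div d - x)) = q"
      and "(case q of (a,b,x,y) \<Rightarrow> (a,x)) \<in> (SIGMA d:{d. d dvd m \<and> d > 0}. {1..<m div d})"
      and "(case case q of (a,b,x,y) \<Rightarrow> (a,x) of (d,x) \<Rightarrow> Q d d) = (case q of (a,b,x,y) \<Rightarrow> Q a b)"
      using q by auto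
  next
    fix p assume "p \<in> (SIGMA d:{d. d dvd m \<and> d > 0}. {1..<m div d})"
    then obtain d x where p: "p = (d,x)" "d > 0" "d dvd m" "0 < x" "x < m div d" by auto
    have "d * x + d * (m div d - x) = m"
      using p by (simp flip: distrib_left)
    thus "(case case p of (d,x) \<Rightarrow> (d,d,x,m div d - x) of (a,b,x,y) \<Rightarrow> (a,x)) = p"
      and "(case p of (d,x) \<Rightarrow> (d,d,x,m div d - x)) \<in> {(a,b,x,y). (a,b,x,y) \<in> bilinear_reps m \<and> a = b}"
      using p by (auto simp: bilinear_reps_def)
  qed
  also have "\<dots> = (\<Sum>d | d dvd m \<and> d > 0. \<Sum>x\<in>{1..<m div d}. Q d d)"
    by (rule sum.Sigma[symmetric]) (use assms in auto)
  finally show ?thesis by simp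
qed

text \<open>With x = y the equation reads (a + b) x = m, so the divisor is d = a + b, and a runs
  from 1 to d - 1.\<close>

lemma sum_bilinear_reps_snd_diagonal:
  fixes Q :: "nat \<Rightarrow> nat \<Rightarrow> real"
  assumes "m > 0"
  shows "(\<Sum>(a,b,x,y) | (a,b,x,y) \<in> bilinear_reps m \<and> x = y. Q a b)
       = (\<Sum>d | d dvd m \<and> d > 0. \<Sum>a\<in>{1..<d}. Q a (d - a))"
proof -
  have "(\<Sum>(a,b,x,y) | (a,b,x,y) \<in> bilinear_reps m \<and> x = y. Q a b)
      = (\<Sum>(d,a)\<in>(SIGMA d:{d. d dvd m \<and> d > 0}. {1..<d}). Q a (d - a))"
  proof (rule sum.reindex_bij_witness[where i = "\<lambda>(d,a). (a,d-a,m div d,m div d)"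
        and j = "\<lambda>(a,b,x,y). (a+b,a)"])
    fix q assume "q \<in> {(a,b,x,y). (a,b,x,y) \<in> bilinear_reps m \<and> x = y}"
    then obtain a b x where q: "q = (a,b,x,x)" "a > 0" "b > 0" "x > 0" "m = (a + b) * x"
      by (auto simp: bilinear_reps_def algebra_simps)
    hence "m div (a + b) = x" by (metis add_is_0 gr_implies_not_zero nonzero_mult_div_cancel_left)
    thus "(case case q of (a,b,x,y) \<Rightarrow> (a+b,a) of (d,a) \<Rightarrow> (a,d-a,m div d,m div d)) = q"
      and "(case q of (a,b,x,y) \<Rightarrow> (a+b,a)) \<in> (SIGMA d:{d. d dvd m \<and> d > 0}. {1..<d})"
      and "(case case q of (a,b,x,y) \<Rightarrow> (a+b,a) of (d,a) \<Rightarrow> Q a (d-a)) = (case q of (a,b,x,y) \<Rightarrow> Q a b)"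
      using q by auto
  next
    fix p assume "p \<in> (SIGMA d:{d. d dvd m \<and> d > 0}. {1..<d})"
    then obtain d a where p: "p = (d,a)" "d > 0" "d dvd m" "0 < a" "a < d" by auto
    have "a * (m div d) + (d - a) * (m div d) = m"
      using p by (simp flip: distrib_right)
    thus "(case case p of (d,a) \<Rightarrow> (a,d-a,m div d,m div d) of (a,b,x,y) \<Rightarrow> (a+b,a)) = p"
      and "(case p of (d,a) \<Rightarrow> (a,d-a,m div d,m div d)) \<in> {(a,b,x,y). (a,b,x,y) \<in> bilinear_reps m \<and> x = y}"
      using p assms by (auto simp: bilinear_reps_def dvd_imp_le div_greater_zero_iff)
  qed
  also have "\<dots> = (\<Sum>d | d dvd m \<and> d > 0. \<Sum>a\<in>{1..<d}. Q a (d - a))"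
    by (rule sum.Sigma[symmetric]) (use assms in auto)
  finally show ?thesis .
qed

lemma sum_squares_below: "(\<Sum>a\<in>{1..<d}. real a ^ 2) = (2 * real d ^ 3 - 3 * real d ^ 2 + real d) / 6"
proof (induction d)
  case (Suc d)
  then show ?case by (cases "d = 0") (auto simp: field_simps power2_eq_square power3_eq_cube)
qed simp

lemma sum_mult_diff_below: "(\<Sum>a\<in>{1..<d}. real a * real (d - a)) = (real d ^ 3 - real d) / 6"
proof -
  have lin: "(\<Sum>a\<in>{1..<d}. real a) = (real d ^ 2 - real d) / 2" for d
    by (induction d) (auto simp: field_simps power2_eq_square)
  have "(\<Sum>a\<in>{1..<d}. real a * real (d - a)) = (\<Sum>a\<in>{1..<d}. real d * real a - real a ^ 2)"
    by (rule sum.cong) (auto simp: of_nat_diff algebra_simps power2_eq_square)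
  also have "\<dots> = real d * (\<Sum>a\<in>{1..<d}. real a) - (\<Sum>a\<in>{1..<d}. real a ^ 2)"
    by (simp add: sum_subtractf sum_distrib_left)
  also have "\<dots> = (real d ^ 3 - real d) / 6"
    unfolding lin sum_squares_below by (simp add: field_simps power2_eq_square power3_eq_cube)
  finally show ?thesis .
qed

lemma real_divisor_sigma: "real (divisor_sigma l m) = (\<Sum>d | d dvd m \<and> d > 0. real d ^ l)"
  by (simp add: divisor_sigma_def)

text \<open>This is equivalent to Glaisher's evaluation of the convolution square of \<open>\<sigma>\<^sub>1\<close>. The
  Euclidean step turns the sums over \<open>b < a\<close> of the three monomials of degree 2 into sums over
  \<open>x < y\<close>; comparing with the two trichotomies gives enough linear equations to solve for them.\<close>

lemma sum_bilinear_reps_mult_less: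
  assumes "m > 0"
  shows "24 * (\<Sum>(a,b,x,y) | (a,b,x,y) \<in> bilinear_reps m \<and> b < a. real a * real b)
       = 5 * real (divisor_sigma 3 m) + 12 * real (divisor_sigma 2 m)
         + real (divisor_sigma 1 m) - 18 * (real m * real (divisor_sigma 1 m))"
proof -
  define A where "A Q = (\<Sum>(a,b,x,y) | (a,b,x,y) \<in> bilinear_reps m \<and> b < a. Q a b)"
    for Q :: "nat \<Rightarrow> nat \<Rightarrow> real"
  define B where "B Q = (\<Sum>(a,b,x,y) | (a,b,x,y) \<in> bilinear_reps m \<and> x < y. Q a b)"
    for Q :: "nat \<Rightarrow> nat \<Rightarrow> real"
  define D where "D Q = (\<Sum>(a,b,x,y) | (a,b,x,y) \<in> bilinear_reps m \<and> a = b. Q a b)"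
    for Q :: "nat \<Rightarrow> nat \<Rightarrow> real"
  define E where "E Q = (\<Sum>(a,b,x,y) | (a,b,x,y) \<in> bilinear_reps m \<and> x = y. Q a b)"
    for Q :: "nat \<Rightarrow> nat \<Rightarrow> real"
  define aa ab bb :: "nat \<Rightarrow> nat \<Rightarrow> real"
    where "aa = (\<lambda>a b. real a ^ 2)" and "ab = (\<lambda>a b. real a * real b)" and "bb = (\<lambda>a b. real b ^ 2)"
  have euclid: "A Q = B (\<lambda>a b. Q (a + b) b)" for Q
    unfolding A_def B_def by (rule sum_bilinear_reps_euclid)
  have tri: "A Q + A (\<lambda>a b. Q b a) + D Q = B Q + B (\<lambda>a b. Q b a) + E Q" for Q
    using sum_bilinear_reps_trichotomy[of Q m] unfolding A_def B_def D_def E_def by linarith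
  have "A aa = B aa + 2 * B ab + B bb"
    unfolding euclid B_def aa_def ab_def bb_def
    by (simp add: sum_distrib_left case_prod_unfold power2_sum algebra_simps flip: sum.distrib)
  moreover have "A ab = B ab + B bb"
    unfolding euclid B_def aa_def ab_def bb_def
    by (simp add: case_prod_unfold power2_eq_square algebra_simps flip: sum.distrib)
  moreover have "A bb = B bb"
    unfolding euclid bb_def ..
  moreover have "2 * A ab + D ab = 2 * B ab + E ab"
    using tri[of ab] by (simp add: ab_def mult.commute)
  moreover have "A aa + A bb + D aa = B aa + B bb + E aa"
    using tri[of aa] by (simp add: aa_def bb_def)
  moreover have "D ab = D aa"
    unfolding D_def ab_def aa_def by (rule sum.cong) (auto simp: power2_eq_square)
  \<comment> \<open>Eliminating the \<open>A\<close> terms from the trichotomies leaves 2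
    \<open>B bb\<close> = \<open>E ab\<close> - \<open>D aa\<close> and 2 \<open>B ab\<close> +
    \<open>B bb\<close> = \<open>E aa\<close> - \<open>D aa\<close>, which determine
    \<open>A ab\<close> = \<open>B ab\<close> + \<open>B bb\<close>.\<close>
  ultimately have "2 * A ab = E aa + E ab / 2 - 3 / 2 * D aa"
    by argo
  moreover have "D aa = real m * real (divisor_sigma 1 m) - real (divisor_sigma 2 m)"
  proof -
    have "D aa = (\<Sum>d | d dvd m \<and> d > 0. real (m div d - 1) * real d ^ 2)"
      unfolding D_def aa_def by (rule sum_bilinear_reps_fst_diagonal[OF assms])
    also have "\<dots> = (\<Sum>d | d dvd m \<and> d > 0. real m * real d ^ 1 - real d ^ 2)"
    proof (rule sum.cong[OF refl], clarify)
      fix d assume d: "d dvd m" "d > 0"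
      then obtain e where m: "m = d * e" by blast
      \<comment> \<open>Since the cofactor is positive, the truncated subtraction in
        \<open>m div d - 1\<close> is a true one.\<close>
      with assms have "e \<ge> 1" by (cases e) auto
      thus "real (m div d - 1) * real d ^ 2 = real m * real d ^ 1 - real d ^ 2"
        using d m by (simp add: of_nat_diff power2_eq_square algebra_simps)
    qed
    finally show ?thesis by (simp add: real_divisor_sigma sum_subtractf sum_distrib_left)
  qed
  moreover have "E aa = (2 * real (divisor_sigma 3 m) - 3 * real (divisor_sigma 2 m) + real (divisor_sigma 1 m)) / 6"
  proof -
    have "E aa = (\<Sum>d | d dvd m \<and> d > 0. (2 * real d ^ 3 - 3 * real d ^ 2 + real d) / 6)"
      unfolding E_def aa_def sum_bilinear_reps_snd_diagonal[OF assms] sum_squares_below ..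
    thus ?thesis
      by (simp add: real_divisor_sigma sum_subtractf sum.distrib sum_distrib_left flip: sum_divide_distrib)
  qed
  moreover have "E ab = (real (divisor_sigma 3 m) - real (divisor_sigma 1 m)) / 6"
  proof -
    have "E ab = (\<Sum>d | d dvd m \<and> d > 0. (real d ^ 3 - real d) / 6)"
      unfolding E_def ab_def sum_bilinear_reps_snd_diagonal[OF assms] sum_mult_diff_below ..
    thus ?thesis
      by (simp add: real_divisor_sigma sum_subtractf flip: sum_divide_distrib)
  qed
  ultimately have "24 * A ab = 5 * real (divisor_sigma 3 m) + 12 * real (divisor_sigma 2 m)
         + real (divisor_sigma 1 m) - 18 * (real m * real (divisor_sigma 1 m))"
    by argo
  thus ?thesis unfolding A_def ab_def .
qed

section \<open>Sums over partitions\<close>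

definition partitions_of :: "nat \<Rightarrow> nat multiset set" where
  "partitions_of n = {M. (\<forall>x \<in># M. x > 0) \<and> sum_mset M = n}"

lemma partition_count_eq_card: "partition_count n = card (partitions_of n)"
  by (simp add: partition_count_def partitions_of_def)

lemma count_mult_le_sum_mset: "count M k * k \<le> sum_mset (M :: nat multiset)"
proof -
  have "replicate_mset (count M k) k \<subseteq># M" by (simp add: count_le_replicate_mset_subset_eq[symmetric])
  then obtain N where "M = replicate_mset (count M k) k + N" by (auto simp: mset_subset_eq_exists_conv)
  hence "sum_mset M = count M k * k + sum_mset N" by (metis sum_mset.union sum_mset_replicate_mset of_nat_id)
  thus ?thesis by simp
qed

lemma size_le_sum_mset:
  assumes "\<forall>x \<in># M. (x::nat) > 0" shows "size M \<le> sum_mset M"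
  using assms by (induction M) (auto simp: Suc_le_eq)

lemma partitions_of_le:
  assumes "M \<in> partitions_of n" "k \<in># M" shows "k \<le> n"
  using assms multi_member_split[of k M] by (auto simp: partitions_of_def)

lemma finite_partitions_of: "finite (partitions_of n)"
proof (rule finite_subset)
  show "partitions_of n \<subseteq> mset ` {xs. set xs \<subseteq> {..n} \<and> length xs \<le> n}"
  proof
    fix M assume M: "M \<in> partitions_of n"
    obtain xs where xs: "M = mset xs" using ex_mset[of M] by auto
    have "size M \<le> n" using size_le_sum_mset[of M] M by (simp add: partitions_of_def)
    thus "M \<in> mset ` {xs. set xs \<subseteq> {..n} \<and> length xs \<le> n}"
      using partitions_of_le[OF M] xs by auto
  qed
qed (simp add: finite_lists_length_le)

text \<open>Taking \<open>R\<close> out and putting it back are inverse to each other. This is how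
  partition numbers enter: each statistic of a partition below is written as a sum of indicators of
  such containments.\<close>

lemma card_partitions_of_supset:
  assumes "\<forall>x \<in># R. x > 0"
  shows "card {M \<in> partitions_of n. R \<subseteq># M}
       = (if sum_mset R \<le> n then partition_count (n - sum_mset R) else 0)"
proof (cases "sum_mset R \<le> n")
  case True
  have "bij_betw (\<lambda>M. M - R) {M \<in> partitions_of n. R \<subseteq># M} (partitions_of (n - sum_mset R))"
  proof (rule bij_betwI[where g = "\<lambda>M. M + R"])
    show "(\<lambda>M. M - R) \<in> {M \<in> partitions_of n. R \<subseteq># M} \<rightarrow> partitions_of (n - sum_mset R)"
      by (auto simp: partitions_of_def sum_mset_diff dest: in_diffD)
    show "(\<lambda>M. M + R) \<in> partitions_of (n - sum_mset R) \<rightarrow> {M \<in> partitions_of n. R \<subseteq># M}"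
      using assms True by (auto simp: partitions_of_def)
  qed auto
  from bij_betw_same_card[OF this] show ?thesis using True by (simp add: partition_count_eq_card)
next
  case False
  have "{M \<in> partitions_of n. R \<subseteq># M} = {}"
    using False by (auto simp: partitions_of_def mset_subset_eq_exists_conv)
  thus ?thesis using False by (simp only: card.empty if_False)
qed

section \<open>Part statistics summed over all partitions\<close>

lemma sum_partitions_of_bool_subset:
  assumes "\<forall>x \<in># R. x > 0"
  shows "(\<Sum>M\<in>partitions_of n. of_bool (R \<subseteq># M))
       = (if sum_mset R \<le> n then real (partition_count (n - sum_mset R)) else 0)"
proof -
  have "(\<Sum>M\<in>partitions_of n. of_bool (R \<subseteq># M) :: real) = real (card {M \<in> partitions_of n. R \<subseteq># M})"
    using finite_partitions_of by (simp add: of_bool_def sum.If_cases Int_def)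
  thus ?thesis by (simp add: card_partitions_of_supset[OF assms])
qed

text \<open>A multiplicity is the number of i > 0 for which i copies are contained. Cutting i off at
  \<open>n\<close> loses nothing, because positive parts summing to \<open>n\<close> have
  multiplicity at most \<open>n\<close>.\<close>

lemma real_count_partition:
  assumes "M \<in> partitions_of n" "k > 0"
  shows "real (count M k) = (\<Sum>i = 1..n. of_bool (replicate_mset i k \<subseteq># M))"
proof -
  have "count M k \<le> count M k * k" using assms by simp
  also have "\<dots> \<le> n" using count_mult_le_sum_mset[of M k] assms by (simp add: partitions_of_def)
  finally have "{1..n} \<inter> {i. i \<le> count M k} = {1..count M k}" by auto
  thus ?thesis by (simp add: of_bool_def sum.If_cases flip: count_le_replicate_mset_subset_eq)
qed

text \<open>Terms of weight above \<open>n\<close> vanish, the others are collected by their weight;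
  positivity of \<open>h\<close> lets the weights start at 1.\<close>

lemma sum_group_partition_weight:
  fixes g :: "'a \<Rightarrow> real" and h :: "'a \<Rightarrow> nat"
  assumes "finite S" "\<And>q. q \<in> S \<Longrightarrow> h q > 0"
  shows "(\<Sum>q\<in>S. g q * (if h q \<le> n then real (partition_count (n - h q)) else 0))
       = (\<Sum>m = 1..n. (\<Sum>q | q \<in> S \<and> h q = m. g q) * real (partition_count (n - m)))"
proof -
  have "(\<Sum>q\<in>S. g q * (if h q \<le> n then real (partition_count (n - h q)) else 0))
      = (\<Sum>q | q \<in> S \<and> h q \<le> n. g q * real (partition_count (n - h q)))"
    by (rule sum.mono_neutral_cong_right) (use assms in auto)
  also have "\<dots> = (\<Sum>m = 1..n. \<Sum>q | q \<in> {q. q \<in> S \<and> h q \<le> n} \<and> h q = m.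
      g q * real (partition_count (n - h q)))"
    by (rule sum.group[symmetric]) (use assms in \<open>auto simp: Suc_le_eq\<close>)
  also have "\<dots> = (\<Sum>m = 1..n. (\<Sum>q | q \<in> S \<and> h q = m. g q) * real (partition_count (n - m)))"
    unfolding sum_distrib_right by (intro sum.cong) auto
  finally show ?thesis .
qed

text \<open>There are P(n - k i) partitions containing i copies of k. Collecting by m = k i leaves k
  running over the divisors of m.\<close>

lemma sum_partitions_count:
  fixes f :: "nat \<Rightarrow> real"
  shows "(\<Sum>M\<in>partitions_of n. \<Sum>k = 1..n. f k * real (count M k))
       = (\<Sum>m = 1..n. (\<Sum>d | d dvd m \<and> d > 0. f d) * real (partition_count (n - m)))"
proof -
  have "(\<Sum>M\<in>partitions_of n. \<Sum>k = 1..n. f k * real (count M k))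
      = (\<Sum>M\<in>partitions_of n. \<Sum>k = 1..n. \<Sum>i = 1..n. f k * of_bool (replicate_mset i k \<subseteq># M))"
    by (intro sum.cong refl) (simp add: real_count_partition sum_distrib_left)
  also have "\<dots> = (\<Sum>k = 1..n. \<Sum>i = 1..n. \<Sum>M\<in>partitions_of n. f k * of_bool (replicate_mset i k \<subseteq># M))"
    by (subst sum.swap, intro sum.cong refl, rule sum.swap)
  also have "\<dots> = (\<Sum>k = 1..n. \<Sum>i = 1..n. f k *
      (if k * i \<le> n then real (partition_count (n - k * i)) else 0))"
  proof (intro sum.cong refl)
    fix k i assume "k \<in> {1..n}" "i \<in> {1..n}"
    thus "(\<Sum>M\<in>partitions_of n. f k * of_bool (replicate_mset i k \<subseteq># M))
        = f k * (if k * i \<le> n then real (partition_count (n - k * i)) else 0)"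
      using sum_partitions_of_bool_subset[of "replicate_mset i k" n]
      by (simp add: mult.commute flip: sum_distrib_left)
  qed
  also have "\<dots> = (\<Sum>(k,i)\<in>{1..n} \<times> {1..n}. f k *
      (if k * i \<le> n then real (partition_count (n - k * i)) else 0))"
    by (rule sum.cartesian_product)
  also have "\<dots> = (\<Sum>q\<in>{1..n} \<times> {1..n}. f (fst q) *
      (if fst q * snd q \<le> n then real (partition_count (n - fst q * snd q)) else 0))"
    by (simp add: case_prod_unfold)
  also have "\<dots> = (\<Sum>m = 1..n. (\<Sum>q | q \<in> {1..n} \<times> {1..n} \<and> fst q * snd q = m. f (fst q))
      * real (partition_count (n - m)))"
    by (rule sum_group_partition_weight) auto
  also have "\<dots> = (\<Sum>m = 1..n. (\<Sum>d | d dvd m \<and> d > 0. f d) * real (partition_count (n - m)))"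
  proof (intro sum.cong refl arg_cong2[where f = "(*)"])
    fix m assume m: "m \<in> {1..n}"
    \<comment> \<open>Cofactors are at most \<open>m\<close>, hence at most \<open>n\<close>, so the
      square of side \<open>n\<close> contains every factorisation of \<open>m\<close>.\<close>
    have le: "m div d \<le> n" for d using m div_le_dividend[of m d] by (meson atLeastAtMost_iff le_trans)
    show "(\<Sum>q | q \<in> {1..n} \<times> {1..n} \<and> fst q * snd q = m. f (fst q)) = (\<Sum>d | d dvd m \<and> d > 0. f d)"
    proof (rule sum.reindex_bij_witness[where i = "\<lambda>d. (d, m div d)" and j = fst])
      fix d assume d: "d \<in> {d. d dvd m \<and> d > 0}"
      hence "d \<le> m" "0 < m div d"
        using m by (auto simp: dvd_imp_le div_greater_zero_iff)
      thus "(d, m div d) \<in> {q. q \<in> {1..n} \<times> {1..n} \<and> fst q * snd q = m}"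
        using d m le by auto
    qed auto
  qed
  finally show ?thesis .
qed

text \<open>Blocks of different values do not compete for elements. This turns a product of two
  indicators into one.\<close>

lemma replicate_mset_add_subset_iff:
  assumes "k \<noteq> l"
  shows "replicate_mset i k + replicate_mset j l \<subseteq># M \<longleftrightarrow> replicate_mset i k \<subseteq># M \<and> replicate_mset j l \<subseteq># M"
proof -
  have "replicate_mset i k + replicate_mset j l \<subseteq># M \<longleftrightarrow> i \<le> count M k \<and> j \<le> count M l"
    using assms by (auto simp: subseteq_mset_def dest: spec[of _ k] spec[of _ l])
  thus ?thesis by (simp add: count_le_replicate_mset_subset_eq)
qed

text \<open>The two-block analogue of \<open>sum_partitions_count\<close>: i copies of k together
  with j copies of l occur in P(n - k i - l j) partitions, and k i + l j = m is the equation of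
  \<open>bilinear_reps m\<close>.\<close>

lemma sum_partitions_count_pairs:
  "(\<Sum>M\<in>partitions_of n. \<Sum>(k,l) | k \<in> {1..n} \<and> l \<in> {1..n} \<and> l < k.
      (real k * real (count M k)) * (real l * real (count M l)))
   = (\<Sum>m = 1..n. (\<Sum>(a,b,x,y) | (a,b,x,y) \<in> bilinear_reps m \<and> b < a. real a * real b)
        * real (partition_count (n - m)))"
proof -
  let ?L = "{(k,l). k \<in> {1..n} \<and> l \<in> {1..n} \<and> l < k}"
  let ?I = "{1..n} \<times> {1..n}"
  let ?h = "\<lambda>(p,q). fst p * fst q + snd p * snd q"
  have finL: "finite ?L" by (rule finite_subset[of _ "{1..n} \<times> {1..n}"]) auto
  have "(\<Sum>M\<in>partitions_of n. \<Sum>(k,l)\<in>?L. (real k * real (count M k)) * (real l * real (count M l)))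
      = (\<Sum>M\<in>partitions_of n. \<Sum>p\<in>?L. \<Sum>q\<in>?I. real (fst p) * real (snd p) *
          of_bool (replicate_mset (fst q) (fst p) + replicate_mset (snd q) (snd p) \<subseteq># M))"
  proof (intro sum.cong refl)
    fix M p assume M: "M \<in> partitions_of n" and p: "p \<in> ?L"
    obtain k l where kl: "p = (k,l)" by force
    have "real (count M k) * real (count M l)
        = (\<Sum>i = 1..n. \<Sum>j = 1..n. of_bool (replicate_mset i k \<subseteq># M) * of_bool (replicate_mset j l \<subseteq># M))"
      using M p kl by (simp only: sum_product[symmetric]) (auto simp: real_count_partition[of M n] simp del: sum_of_bool_eq)
    also have "\<dots> = (\<Sum>q\<in>?I. of_bool (replicate_mset (fst q) k + replicate_mset (snd q) l \<subseteq># M))"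
      unfolding sum.cartesian_product
      by (rule sum.cong) (use p kl in \<open>auto simp: replicate_mset_add_subset_iff\<close>)
    finally show "(case p of (k,l) \<Rightarrow> (real k * real (count M k)) * (real l * real (count M l)))
      = (\<Sum>q\<in>?I. real (fst p) * real (snd p) *
          of_bool (replicate_mset (fst q) (fst p) + replicate_mset (snd q) (snd p) \<subseteq># M))"
      using kl by (simp add: algebra_simps flip: sum_distrib_left)
  qed
  also have "\<dots> = (\<Sum>p\<in>?L. \<Sum>q\<in>?I. \<Sum>M\<in>partitions_of n. real (fst p) * real (snd p) *
          of_bool (replicate_mset (fst q) (fst p) + replicate_mset (snd q) (snd p) \<subseteq># M))"
    by (subst sum.swap, intro sum.cong refl, rule sum.swap)
  also have "\<dots> = (\<Sum>p\<in>?L. \<Sum>q\<in>?I. real (fst p) * real (snd p) *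
      (if ?h (p,q) \<le> n then real (partition_count (n - ?h (p,q))) else 0))"
  proof (intro sum.cong refl)
    fix p q assume "p \<in> ?L" "q \<in> ?I"
    thus "(\<Sum>M\<in>partitions_of n. real (fst p) * real (snd p) *
          of_bool (replicate_mset (fst q) (fst p) + replicate_mset (snd q) (snd p) \<subseteq># M))
        = real (fst p) * real (snd p) * (if ?h (p,q) \<le> n then real (partition_count (n - ?h (p,q))) else 0)"
      using sum_partitions_of_bool_subset[of "replicate_mset (fst q) (fst p) + replicate_mset (snd q) (snd p)" n]
      by (auto simp: mult.commute simp flip: sum_distrib_left)
  qed
  also have "\<dots> = (\<Sum>r\<in>?L \<times> ?I. (real (fst (fst r)) * real (snd (fst r))) *
      (if ?h r \<le> n then real (partition_count (n - ?h r)) else 0))"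
    unfolding sum.cartesian_product by (rule sum.cong) auto
  also have "\<dots> = (\<Sum>m = 1..n. (\<Sum>r | r \<in> ?L \<times> ?I \<and> ?h r = m. real (fst (fst r)) * real (snd (fst r)))
      * real (partition_count (n - m)))"
    by (rule sum_group_partition_weight) (use finL in auto)
  also have "\<dots> = (\<Sum>m = 1..n. (\<Sum>(a,b,x,y) | (a,b,x,y) \<in> bilinear_reps m \<and> b < a. real a * real b)
        * real (partition_count (n - m)))"
  proof (intro sum.cong refl arg_cong2[where f = "(*)"])
    fix m assume m: "m \<in> {1..n}"
    show "(\<Sum>r | r \<in> ?L \<times> ?I \<and> ?h r = m. real (fst (fst r)) * real (snd (fst r)))
        = (\<Sum>(a,b,x,y) | (a,b,x,y) \<in> bilinear_reps m \<and> b < a. real a * real b)"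
    proof (rule sum.reindex_bij_witness[where i = "\<lambda>(a,b,x,y). ((a,b),(x,y))"
          and j = "\<lambda>((a,b),(x,y)). (a,b,x,y)"])
      fix q assume q: "q \<in> {(a,b,x,y). (a,b,x,y) \<in> bilinear_reps m \<and> b < a}"
      then obtain a b x y where h: "q = (a,b,x,y)" "b < a" "0 < a" "0 < b" "0 < x" "0 < y" "a * x + b * y = m"
        by (auto simp: bilinear_reps_def)
      \<comment> \<open>Each unknown is bounded by its product, so every solution for
        \<open>m\<close> lies in the box of side \<open>n\<close>.\<close>
      have "a \<le> a * x" "x \<le> a * x" "b \<le> b * y" "y \<le> b * y" using h by simp_all
      moreover have "a * x + b * y \<le> n" using h(7) m by simp
      ultimately have "a \<le> n" "x \<le> n" "b \<le> n" "y \<le> n" by linarith+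
      thus "(case q of (a,b,x,y) \<Rightarrow> ((a,b),(x,y))) \<in> {r. r \<in> ?L \<times> ?I \<and> ?h r = m}"
        using h by auto
    qed (auto simp: bilinear_reps_def)
  qed
  finally show ?thesis .
qed

lemma sum_mset_eq_sum_count:
  assumes "finite S" "set_mset M \<subseteq> S"
  shows "sum_mset M = (\<Sum>k\<in>S. k * count M k :: nat)"
  using assms(2)
proof (induction M)
  case (add x M)
  have "(\<Sum>k\<in>S. k * count (add_mset x M) k) = (\<Sum>k\<in>S. k * count M k + (if k = x then k else 0))"
    by (rule sum.cong) auto
  also have "\<dots> = sum_mset M + x"
    using add assms(1) by (simp add: sum.distrib)
  finally show ?case by simp
qed simp

lemma sum_count_mult_partition:
  assumes "M \<in> partitions_of n"
  shows "(\<Sum>k = 1..n. real k * real (count M k)) = real n"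
proof -
  have "set_mset M \<subseteq> {1..n}"
    using assms partitions_of_le[OF assms] by (auto simp: partitions_of_def Suc_le_eq)
  hence "n = (\<Sum>k = 1..n. k * count M k)"
    using assms sum_mset_eq_sum_count[of "{1..n}" M] by (simp add: partitions_of_def)
  thus ?thesis by (metis (mono_tags, lifting) of_nat_mult of_nat_sum sum.cong)
qed

text \<open>Euler's recurrence for the partition numbers: the parts of all partitions of
  \<open>n\<close> are added up in two ways. It supplies the last term of the final formula.\<close>

lemma sum_divisor_sigma_1_partition_count:
  "(\<Sum>m = 1..n. real (divisor_sigma 1 m) * real (partition_count (n - m))) = real n * real (partition_count n)"
proof -
  have "(\<Sum>m = 1..n. real (divisor_sigma 1 m) * real (partition_count (n - m)))
      = (\<Sum>M\<in>partitions_of n. \<Sum>k = 1..n. real k * real (count M k))"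
    unfolding sum_partitions_count by (simp add: real_divisor_sigma)
  also have "\<dots> = real n * real (partition_count n)"
    by (simp add: sum_count_mult_partition partition_count_eq_card del: One_nat_def)
  finally show ?thesis .
qed

text \<open>Three times the number of 3-cycles \<open>c\<close> such that \<open>c \<circ> s\<close> is conjugate to a permutation \<open>s\<close>
  of cycle type \<open>M\<close>.\<close>

definition three_cycle_weight :: "nat \<Rightarrow> nat multiset \<Rightarrow> real" where
  "three_cycle_weight n M = (\<Sum>k = 1..n. (real k * (real k - 1) * (real k - 2) / 2) * real (count M k))
     + 3 * (\<Sum>(k,l) | k \<in> {1..n} \<and> l \<in> {1..n} \<and> l < k.
             (real k * real (count M k)) * (real l * real (count M l)))"

text \<open>In the coefficient of P(n - m) the single cycles contribute sigma_3/2 - (3/2) sigma_2 +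
  sigma_1, and the pairs contribute one eighth of 5 sigma_3 + 12 sigma_2 + sigma_1 - 18 m sigma_1.
  The sigma_2 terms cancel, and 9/8 is a common factor of the rest.\<close>

lemma sum_three_cycle_weight:
  "(\<Sum>M\<in>partitions_of n. three_cycle_weight n M)
   = 9 / 8 * ((\<Sum>k = 1..n. real (divisor_sigma 3 k) * real (partition_count (n - k)))
              - 2 * (\<Sum>k = 1..n. real k * real (divisor_sigma 1 k) * real (partition_count (n - k)))
              + real n * real (partition_count n))"
proof -
  have "(\<Sum>M\<in>partitions_of n. three_cycle_weight n M)
      = (\<Sum>m = 1..n. (\<Sum>d | d dvd m \<and> d > 0. real d * (real d - 1) * (real d - 2) / 2) * real (partition_count (n - m)))
      + 3 * (\<Sum>m = 1..n. (\<Sum>(a,b,x,y) | (a,b,x,y) \<in> bilinear_reps m \<and> b < a. real a * real b)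
        * real (partition_count (n - m)))"
    unfolding three_cycle_weight_def sum.distrib sum_partitions_count sum_distrib_left[symmetric]
      sum_partitions_count_pairs ..
  also have "\<dots> = (\<Sum>m = 1..n. ((\<Sum>d | d dvd m \<and> d > 0. real d * (real d - 1) * (real d - 2) / 2)
      + 3 * (\<Sum>(a,b,x,y) | (a,b,x,y) \<in> bilinear_reps m \<and> b < a. real a * real b)) * real (partition_count (n - m)))"
    unfolding distrib_right sum.distrib sum_distrib_left[of 3 _ "{1..n}"] mult.assoc ..
  also have "\<dots> = (\<Sum>m = 1..n. (9 / 8 * (real (divisor_sigma 3 m) - 2 * (real m * real (divisor_sigma 1 m))
      + real (divisor_sigma 1 m))) * real (partition_count (n - m)))"
  proof (intro sum.cong refl arg_cong2[where f = "(*)"])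
    fix m assume "m \<in> {1..n}"
    hence "m > 0" by simp
    have "(\<Sum>d | d dvd m \<and> d > 0. real d * (real d - 1) * (real d - 2) / 2)
        = (\<Sum>d | d dvd m \<and> d > 0. real d ^ 3 / 2 - 3 / 2 * real d ^ 2 + real d ^ 1)"
      by (intro sum.cong refl) (simp add: field_simps power2_eq_square power3_eq_cube)
    also have "\<dots> = real (divisor_sigma 3 m) / 2 - 3 / 2 * real (divisor_sigma 2 m) + real (divisor_sigma 1 m)"
      unfolding real_divisor_sigma by (simp add: sum_subtractf sum.distrib sum_distrib_left sum_divide_distrib)
    finally show "(\<Sum>d | d dvd m \<and> d > 0. real d * (real d - 1) * (real d - 2) / 2)
      + 3 * (\<Sum>(a,b,x,y) | (a,b,x,y) \<in> bilinear_reps m \<and> b < a. real a * real b)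
      = 9 / 8 * (real (divisor_sigma 3 m) - 2 * (real m * real (divisor_sigma 1 m)) + real (divisor_sigma 1 m))"
      using sum_bilinear_reps_mult_less[OF \<open>m > 0\<close>] by argo
  qed
  also have "\<dots> = 9 / 8 * ((\<Sum>k = 1..n. real (divisor_sigma 3 k) * real (partition_count (n - k)))
      - 2 * (\<Sum>k = 1..n. real k * real (divisor_sigma 1 k) * real (partition_count (n - k)))
      + (\<Sum>k = 1..n. real (divisor_sigma 1 k) * real (partition_count (n - k))))"
    by (simp add: sum_distrib_left sum_subtractf sum.distrib algebra_simps)
  finally show ?thesis unfolding sum_divisor_sigma_1_partition_count .
qed

section \<open>Cycle types and transpositions\<close>

text \<open>Orbits are collected as a set before their sizes are taken, so a cycle counts once and
  not once per point. Fixed points in \<open>A\<close> are parts equal to 1.\<close>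

definition cycle_type :: "'a set \<Rightarrow> ('a \<Rightarrow> 'a) \<Rightarrow> nat multiset" where
  "cycle_type A p = image_mset card (mset_set (orbit p ` A))"

text \<open>An \<open>orbit\<close> consists of the images under at least one application of
  \<open>p\<close>, so its starting point belongs to it only because a permutation of a finite set
  returns.\<close>

lemma permutes_self_in_orbit:
  assumes "p permutes A" "finite A" shows "x \<in> orbit p x"
  using assms by (meson permutation_permutes permutation_self_in_orbit)

lemma permutes_orbit_eq:
  assumes "p permutes A" "finite A" "y \<in> orbit p x" shows "orbit p y = orbit p x"
  using orbit_cyclic_eq3[OF cyclic_on_orbit[OF assms(1,2)] assms(3)] .

lemma permutes_pairwise_disjnt_orbits:
  assumes "p permutes A" "finite A" shows "pairwise disjnt (range (orbit p))"
proof (rule pairwiseI)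
  fix Y Z assume "Y \<in> range (orbit p)" "Z \<in> range (orbit p)" "Y \<noteq> Z"
  then obtain x y where xy: "Y = orbit p x" "Z = orbit p y" by auto
  have "z \<notin> orbit p y" if "z \<in> orbit p x" for z
    using permutes_orbit_eq[OF assms, of z] that xy \<open>Y \<noteq> Z\<close> by metis
  thus "disjnt Y Z" using xy by (auto simp: disjnt_def)
qed

text \<open>The first return time equals the size of the orbit, so the powers below it name each
  point of the cycle once. All cutting, joining and matching of cycles below uses these
  coordinates.\<close>

lemma orbit_coordinates:
  assumes "x \<in> orbit p x"
  shows "bij_betw (\<lambda>i. (p ^^ i) x) {..<card (orbit p x)} (orbit p x)"
    and "(p ^^ card (orbit p x)) x = x"
proof -
  have inj: "inj_on (\<lambda>i. (p ^^ i) x) {0..<funpow_dist1 p x x}"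
    using assms by (rule inj_on_funpow_dist1)
  have card: "card (orbit p x) = funpow_dist1 p x x"
    by (subst orbit_conv_funpow_dist1[OF assms]) (simp add: card_image[OF inj])
  show "(p ^^ card (orbit p x)) x = x"
    unfolding card using assms by (rule funpow_dist1_prop)
  show "bij_betw (\<lambda>i. (p ^^ i) x) {..<card (orbit p x)} (orbit p x)"
    unfolding card bij_betw_def using inj orbit_conv_funpow_dist1[OF assms]
    by (simp add: lessThan_atLeast0)
qed

lemma orbit_eq_image_lessThan:
  assumes "m > 0" "\<And>i. Suc i < m \<Longrightarrow> r (f i) = f (Suc i)" "r (f (m - 1)) = f 0"
  shows "orbit r (f 0) = f ` {..<m}"
proof -
  have pow: "(r ^^ i) (f 0) = f i" if "i < m" for i
    using that by (induction i) (use assms(2) in auto)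
  have "(r ^^ m) (f 0) = f 0"
    using pow[of "m - 1"] assms(1,3) by (cases m) auto
  hence "orbit r (f 0) = {(r ^^ i) (f 0) |i. i < m}"
    using assms(1) by (intro orbit_altdef_bounded)
  thus ?thesis using pow by (auto simp: image_def) metis
qed

lemma cycle_type_parts:
  assumes "p permutes A" "finite A"
  shows "\<forall>k \<in># cycle_type A p. k > 0" and "sum_mset (cycle_type A p) = card A"
proof -
  have fin: "finite (orbit p ` A)" using assms by simp
  have fo: "finite (orbit p x)" for x using permutes_self_in_orbit[OF assms] by (rule finite_orbit)
  show "\<forall>k \<in># cycle_type A p. k > 0"
    using fo by (auto simp: cycle_type_def fin card_gt_0_iff orbit_nonempty)
  have "\<Union> (orbit p ` A) = A"
    using permutes_orbit_subset[OF assms(1)] permutes_self_in_orbit[OF assms] by blast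
  moreover have "card (\<Union> (orbit p ` A)) = (\<Sum>Y\<in>orbit p ` A. card Y)"
    by (rule card_Union_disjoint, rule pairwise_mono[OF permutes_pairwise_disjnt_orbits[OF assms]])
      (use fo in auto)
  ultimately show "sum_mset (cycle_type A p) = card A"
    by (simp add: cycle_type_def sum_unfold_sum_mset)
qed

text \<open>Orbits are disjoint, and each one of size \<open>j\<close> supplies \<open>j\<close>
  points. This translates counts of points into multiplicities of parts.\<close>

lemma card_orbit_size_eq:
  assumes "p permutes A" "finite A"
  shows "card {a \<in> A. card (orbit p a) = j} = j * count (cycle_type A p) j"
proof -
  have fo: "finite (orbit p x)" for x using permutes_self_in_orbit[OF assms] by (rule finite_orbit)
  have "{a \<in> A. card (orbit p a) = j} = \<Union> {Y \<in> orbit p ` A. card Y = j}"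
  proof (intro set_eqI iffI)
    fix a assume "a \<in> \<Union> {Y \<in> orbit p ` A. card Y = j}"
    then obtain x where x: "x \<in> A" "card (orbit p x) = j" "a \<in> orbit p x" by auto
    thus "a \<in> {a \<in> A. card (orbit p a) = j}"
      using permutes_orbit_subset[OF assms(1)] permutes_orbit_eq[OF assms x(3)] by auto
  qed (use permutes_self_in_orbit[OF assms] in blast)
  also have "card \<dots> = (\<Sum>Y\<in>{Y \<in> orbit p ` A. card Y = j}. card Y)"
    by (rule card_Union_disjoint, rule pairwise_mono[OF permutes_pairwise_disjnt_orbits[OF assms]])
      (use fo in auto)
  also have "\<dots> = j * card {Y \<in> orbit p ` A. card Y = j}" by simp
  also have "card {Y \<in> orbit p ` A. card Y = j} = count (cycle_type A p) j"
    using assms(2) by (simp add: cycle_type_def count_image_mset' Collect_conj_eq Int_commute)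
      (simp add: Int_def eq_commute)
  finally show ?thesis .
qed

section \<open>Effect of a transposition on the cycle type\<close>

lemma permutes_transpose_comp:
  assumes "p permutes A" "b \<in> A" "c \<in> A"
  shows "(transpose b c \<circ> p) permutes A"
  using assms by (intro permutes_compose permutes_swap_id)

text \<open>The point mapped by \<open>p\<close> to \<open>c\<close> is sent to \<open>b\<close>
  instead, and the point mapped to \<open>b\<close> is sent to \<open>c\<close>. So the cycle falls
  into b, ..., p^(d-1) b and c = p^d b, ..., p^(k-1) b, where k is its length. The cycle types are
  compared by adding parts on both sides, which avoids multiset subtraction.\<close>

lemma transpose_split:
  assumes p: "p permutes A" and fin: "finite A" and b: "b \<in> A"
    and d: "0 < d" "d < card (orbit p b)" and c: "c = (p ^^ d) b"
  defines "r \<equiv> transpose b c \<circ> p"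
  shows "add_mset (card (orbit p b)) (cycle_type A r)
         = add_mset d (add_mset (card (orbit p b) - d) (cycle_type A p))"
    and "card (orbit r b) = d" and "card (orbit r c) = card (orbit p b) - d"
    and "c \<notin> orbit r b"
proof -
  define k where "k = card (orbit p b)"
  define f where "f i = (p ^^ i) b" for i
  have self: "x \<in> orbit p x" for x using permutes_self_in_orbit[OF p fin] .
  have bij: "bij_betw f {..<k} (orbit p b)" and fk: "f k = b"
    using orbit_coordinates[OF self[of b]] by (simp_all add: k_def f_def[abs_def])
  have inj: "f i = f j \<longleftrightarrow> i = j" if "i < k" "j < k" for i j
    using bij that by (auto simp: bij_betw_def inj_on_def)
  have f0: "f 0 = b" and fd: "f d = c" by (simp_all add: f_def c)
  have pf: "p (f i) = f (Suc i)" for i by (simp add: f_def)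
  have dk: "d < k" using d by (simp add: k_def)
  \<comment> \<open>Within the cycle, \<open>r\<close> differs from \<open>p\<close> only where
    \<open>p\<close> hits b = f k or c = f d, that is, at i = k - 1 and i = d - 1.\<close>
  have rf: "r (f i) = f (Suc i)" if "Suc i < k" "Suc i \<noteq> d" for i
    using that inj[of "Suc i" 0] inj[of "Suc i" d] dk f0 fd by (auto simp: r_def pf)
  define B C where "B = f ` {..<d}" and "C = f ` {d..<k}"
  have ob: "orbit r b = B"
  proof -
    have "orbit r (f 0) = f ` {..<d}"
    proof (rule orbit_eq_image_lessThan)
      show "r (f (d - 1)) = f 0" using d f0 fd by (simp add: r_def pf)
    qed (use d dk rf in auto)
    thus ?thesis by (simp add: f0 B_def)
  qed
  have oc: "orbit r c = C"
  proof -
    have "orbit r (f (d + 0)) = (\<lambda>i. f (d + i)) ` {..<k - d}"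
    proof (rule orbit_eq_image_lessThan)
      show "r (f (d + (k - d - 1))) = f (d + 0)" using d dk fk fd by (simp add: r_def pf)
    qed (use d dk rf in auto)
    also have "\<dots> = C" unfolding C_def
      by (auto simp: image_iff) (metis add_diff_inverse_nat diff_less_mono lessThan_iff not_less)
    finally show ?thesis by (simp add: fd)
  qed
  have BC: "B \<inter> C = {}" "B \<union> C = orbit p b"
  proof -
    show "B \<inter> C = {}" using inj dk by (auto simp: B_def C_def)
    have "{..<d} \<union> {d..<k} = {..<k}" using dk by auto
    thus "B \<union> C = orbit p b" using bij by (auto simp: B_def C_def bij_betw_def simp flip: image_Un)
  qed
  have cardB: "card B = d" and cardC: "card C = k - d"
    unfolding B_def C_def using inj dk by (auto intro!: card_image[THEN trans] inj_onI)
  show "card (orbit r b) = d" "card (orbit r c) = card (orbit p b) - d"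
    by (simp_all add: ob oc cardB cardC k_def)
  have cC: "c \<in> C" unfolding C_def using dk fd by force
  thus "c \<notin> orbit r b" using BC ob by auto
  have bc: "b \<in> orbit p b" "c \<in> orbit p b" using self BC cC by auto
  \<comment> \<open>A cycle that contains neither \<open>b\<close> nor \<open>c\<close> is never
    touched by the transposition.\<close>
  have other: "orbit r x = orbit p x" if "x \<notin> orbit p b" for x
  proof (rule orbit_cong[OF self])
    fix s assume s: "s \<in> orbit p x"
    hence "p s \<in> orbit p x" by (rule orbit.step)
    hence "orbit p (p s) = orbit p x" by (rule permutes_orbit_eq[OF p fin])
    hence "p s \<noteq> b" "p s \<noteq> c" using that self[of x] bc permutes_orbit_eq[OF p fin, of c b] by auto
    thus "r s = p s" by (simp add: r_def)
  qed
  have rperm: "r permutes A"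
    unfolding r_def using p b bc permutes_orbit_subset[OF p b] by (blast intro: permutes_transpose_comp)
  define X where "X = orbit p ` (A - orbit p b)"
  have finX: "finite X" using fin by (simp add: X_def)
  have X: "Y \<inter> orbit p b = {}" if Y: "Y \<in> X" for Y
  proof -
    obtain x where x: "Y = orbit p x" "x \<notin> orbit p b" using Y by (auto simp: X_def)
    hence "Y \<noteq> orbit p b" using self by auto
    thus ?thesis
      using pairwiseD[OF permutes_pairwise_disjnt_orbits[OF p fin], of Y "orbit p b"] x(1)
      by (auto simp: disjnt_def)
  qed
  have A: "A = (A - orbit p b) \<union> orbit p b" using permutes_orbit_subset[OF p b] by auto
  have "orbit p ` A = X \<union> orbit p ` orbit p b"
    by (subst A) (simp only: image_Un X_def)
  also have "orbit p ` orbit p b = {orbit p b}"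
    using permutes_orbit_eq[OF p fin] self[of b] by blast
  finally have "orbit p ` A = insert (orbit p b) X" by simp
  moreover have "orbit p b \<notin> X" using X[of "orbit p b"] self by blast
  ultimately have tp: "cycle_type A p = add_mset k (image_mset card (mset_set X))"
    using finX by (simp add: cycle_type_def k_def)
  have "orbit r ` A = orbit r ` (A - orbit p b) \<union> orbit r ` (B \<union> C)"
    by (subst A) (simp only: image_Un BC)
  also have "orbit r ` (A - orbit p b) = X"
    unfolding X_def by (rule image_cong) (auto simp: other)
  also have "orbit r ` (B \<union> C) = {B, C}"
  proof -
    have "orbit r x = B" if "x \<in> B" for x using that ob permutes_orbit_eq[OF rperm fin] by metis
    moreover have "orbit r x = C" if "x \<in> C" for x using that oc permutes_orbit_eq[OF rperm fin] by metis
    moreover have "B \<noteq> {}" using ob orbit_nonempty by metis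
    ultimately show ?thesis using cC by (auto simp: image_Un image_constant_conv)
  qed
  finally have "orbit r ` A = insert B (insert C X)" by auto
  moreover have "B \<noteq> {}" "C \<noteq> {}" using ob oc orbit_nonempty by metis+
  moreover from this have "B \<notin> X" "C \<notin> X" "B \<noteq> C" using X BC by blast+
  ultimately have tr: "cycle_type A r = add_mset d (add_mset (k - d) (image_mset card (mset_set X)))"
    using finX by (simp add: cycle_type_def cardB cardC)
  show "add_mset (card (orbit p b)) (cycle_type A r)
         = add_mset d (add_mset (card (orbit p b) - d) (cycle_type A p))"
    unfolding tp tr k_def[symmetric] by (simp add: add_mset_commute)
qed

lemma orbit_obtain_power:
  assumes "p permutes A" "finite A" "c \<in> orbit p b" "c \<noteq> b"
  obtains d where "0 < d" "d < card (orbit p b)" "c = (p ^^ d) b"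
proof -
  obtain d where "d < card (orbit p b)" "c = (p ^^ d) b"
    using orbit_coordinates(1)[OF permutes_self_in_orbit[OF assms(1,2), of b]] assms(3)
    by (auto simp: bij_betw_def)
  moreover from this assms(4) have "0 < d" by (cases d) auto
  ultimately show ?thesis using that by blast
qed

text \<open>A transposition is its own inverse, so joining is splitting read backwards: once
  \<open>b\<close> and \<open>c\<close> are known to share a cycle of \<open>r\<close>,
  \<open>transpose_split\<close> applied to \<open>r\<close> gives back \<open>p\<close>.\<close>

lemma transpose_merge:
  assumes p: "p permutes A" and fin: "finite A" and b: "b \<in> A" "c \<in> A" and nc: "c \<notin> orbit p b"
  defines "r \<equiv> transpose b c \<circ> p"
  shows "add_mset (card (orbit p b) + card (orbit p c)) (cycle_type A p)
         = add_mset (card (orbit p b)) (add_mset (card (orbit p c)) (cycle_type A r))"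
    and "card (orbit r b) = card (orbit p b) + card (orbit p c)"
    and "c = (r ^^ card (orbit p b)) b"
proof -
  define k where "k = card (orbit p b)"
  have self: "x \<in> orbit p x" for x using permutes_self_in_orbit[OF p fin] .
  have bij: "bij_betw (\<lambda>i. (p ^^ i) b) {..<k} (orbit p b)" and fk: "(p ^^ k) b = b"
    using orbit_coordinates[OF self[of b]] by (auto simp: k_def)
  have k: "k > 0" using finite_orbit[OF self[of b]] orbit_nonempty[of p b] by (simp add: k_def card_gt_0_iff)
  \<comment> \<open>From \<open>b\<close> on, \<open>r\<close> follows \<open>p\<close> until
    \<open>p\<close> would close the cycle; that k-th step is diverted to \<open>c\<close>.\<close>
  have pow: "(r ^^ i) b = (p ^^ i) b" if "i < k" for i
    using that
  proof (induction i)
    case (Suc i)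
    have "(p ^^ Suc i) b \<noteq> (p ^^ 0) b"
      using bij Suc.prems k unfolding bij_betw_def inj_on_def by (metis lessThan_iff nat.distinct(1))
    moreover have "(p ^^ Suc i) b \<noteq> c" using nc funpow_in_orbit[OF self[of b]] by metis
    ultimately show ?case using Suc by (simp add: r_def)
  qed simp
  have powk: "(r ^^ k) b = c"
    using pow[of "k - 1"] k fk by (cases k) (auto simp: r_def)
  have cr: "c \<in> orbit r b" unfolding orbit_altdef using powk k by blast
  have r: "r permutes A" unfolding r_def using p b by (rule permutes_transpose_comp)
  have pr: "transpose b c \<circ> r = p" by (simp add: r_def fun_eq_iff)
  have "b \<noteq> c" using nc self by auto
  then obtain d where d: "0 < d" "d < card (orbit r b)" "c = (r ^^ d) b"
    using orbit_obtain_power[OF r fin cr] by metis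
  note split = transpose_split[OF r fin b(1) d, unfolded pr]
  have "card (orbit r b) = card (orbit p b) + card (orbit p c)" using split(2,3) d(2) by simp
  thus "add_mset (card (orbit p b) + card (orbit p c)) (cycle_type A p)
         = add_mset (card (orbit p b)) (add_mset (card (orbit p c)) (cycle_type A r))"
    and "card (orbit r b) = card (orbit p b) + card (orbit p c)"
    using split by simp_all
  show "c = (r ^^ card (orbit p b)) b" using powk k_def by simp
qed

section \<open>Three-cycles preserving the cycle type\<close>

lemma cycle_type_partitions_of:
  assumes "p permutes A" "finite A"
  shows "cycle_type A p \<in> partitions_of (card A)"
  using cycle_type_parts[OF assms] by (auto simp: partitions_of_def)

lemma add_mset_pair_eq_iff:
  "add_mset a (add_mset b M) = add_mset c (add_mset d M) \<longleftrightarrow> a = c \<and> b = d \<or> a = d \<and> b = c"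
proof -
  have "add_mset a (add_mset b M) = {#a, b#} + M" "add_mset c (add_mset d M) = {#c, d#} + M" by auto
  thus ?thesis by (metis add_right_cancel add_eq_conv_ex
        add_mset_eq_singleton_iff add_mset_commute)
qed

text \<open>The first transposition joins cycles of lengths k and l, so the second must cut the
  joined cycle; a further join would lose another cycle. The cut at distance e from \<open>b\<close>
  restores the type iff e = k or e = l. Since e = k means a = c, the one new choice is e = l, and it
  exists exactly when k and l differ.\<close>

lemma card_third_point_merge:
  assumes s: "s permutes A" and fin: "finite A" and bA: "b \<in> A" and cA: "c \<in> A" and nc: "c \<notin> orbit s b"
  shows "card {a \<in> A. a \<noteq> b \<and> a \<noteq> c \<and>
           cycle_type A (transpose a b \<circ> (transpose b c \<circ> s)) = cycle_type A s}
       = of_bool (card (orbit s b) \<noteq> card (orbit s c))"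
proof -
  define r where "r = transpose b c \<circ> s"
  define k l where "k = card (orbit s b)" and "l = card (orbit s c)"
  have r: "r permutes A" unfolding r_def using s bA cA by (rule permutes_transpose_comp)
  note m = transpose_merge[OF s fin bA cA nc, folded r_def k_def l_def]
  have pos: "k > 0" "l > 0"
    using finite_orbit[OF permutes_self_in_orbit[OF s fin]] orbit_nonempty
    by (metis k_def l_def card_gt_0_iff)+
  have bij: "bij_betw (\<lambda>i. (r ^^ i) b) {..<k + l} (orbit r b)"
    using orbit_coordinates(1)[OF permutes_self_in_orbit[OF r fin], of b] by (simp add: m(2))
  have inj: "i = j" if "(r ^^ i) b = (r ^^ j) b" "i < k + l" "j < k + l" for i j
    using bij that by (auto simp: bij_betw_def inj_on_def)
  have sub: "orbit r b \<subseteq> A" using permutes_orbit_subset[OF r bA] .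
  have size: "size (cycle_type A s) = Suc (size (cycle_type A r))"
    using arg_cong[OF m(1), of size] by simp
  have iff: "cycle_type A (transpose a b \<circ> r) = cycle_type A s \<longleftrightarrow> a = c \<or> a = (r ^^ l) b"
    if a: "a \<in> A" "a \<noteq> b" for a
  proof (cases "a \<in> orbit r b")
    case True
    obtain e where e: "0 < e" "e < k + l" "a = (r ^^ e) b"
      using orbit_obtain_power[OF r fin True a(2)] m(2) by metis
    have "add_mset (k + l) (cycle_type A (transpose a b \<circ> r)) = add_mset e (add_mset (k + l - e) (cycle_type A r))"
      using transpose_split(1)[OF r fin bA, of e a] e m(2) by (simp add: transpose_commute)
    hence "cycle_type A (transpose a b \<circ> r) = cycle_type A s \<longleftrightarrow> e = k \<or> e = l"
      using m(1) e add_mset_pair_eq_iff[of e "k + l - e" "cycle_type A r" k l]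
      by (metis add_diff_cancel_left' add_diff_cancel_right' add_mset_add_mset_same_iff)
    also have "\<dots> \<longleftrightarrow> a = c \<or> a = (r ^^ l) b"
      using inj[of e k] inj[of e l] e m(3) pos by auto
    finally show ?thesis .
  next
    case False
    have "size (cycle_type A r) = Suc (size (cycle_type A (transpose a b \<circ> r)))"
      using arg_cong[OF transpose_merge(1)[OF r fin bA a(1) False], of size] by (simp add: transpose_commute)
    hence "size (cycle_type A (transpose a b \<circ> r)) < size (cycle_type A s)" using size by linarith
    hence "cycle_type A (transpose a b \<circ> r) \<noteq> cycle_type A s" by (metis less_irrefl)
    moreover have "a \<noteq> c" "a \<noteq> (r ^^ l) b"
      using False funpow_in_orbit[OF permutes_self_in_orbit[OF r fin]] m(3) by metis+
    ultimately show ?thesis by simp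
  qed
  have lA: "(r ^^ l) b \<in> A" using sub funpow_in_orbit[OF permutes_self_in_orbit[OF r fin, of b]] by blast
  have lb: "(r ^^ l) b \<noteq> b" using inj[of l 0] pos by auto
  have lc: "(r ^^ l) b = c \<longleftrightarrow> k = l" using inj[of l k] m(3) pos by auto
  have "{a \<in> A. a \<noteq> b \<and> a \<noteq> c \<and> cycle_type A (transpose a b \<circ> r) = cycle_type A s}
      = (if k = l then {} else {(r ^^ l) b})"
    using iff lA lb lc by auto
  thus ?thesis unfolding r_def k_def[symmetric] l_def[symmetric] by simp
qed

text \<open>The first transposition cuts the cycle of \<open>b\<close> into lengths d, containing
  \<open>b\<close>, and j, containing \<open>c\<close>. The second must join the piece of
  \<open>b\<close> to some cycle of length j, so \<open>a\<close> is any point on such a cycle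
  outside the piece of \<open>b\<close>. The final 1 is subtracted for a = c.\<close>

lemma card_third_point_split:
  assumes s: "s permutes A" and fin: "finite A" and bA: "b \<in> A"
    and d: "0 < d" "d < card (orbit s b)" and c: "c = (s ^^ d) b"
  defines "j \<equiv> card (orbit s b) - d"
  shows "card {a \<in> A. a \<noteq> b \<and> a \<noteq> c \<and>
           cycle_type A (transpose a b \<circ> (transpose b c \<circ> s)) = cycle_type A s}
       = j * (1 + count (cycle_type A s) j) - 1"
proof -
  define r where "r = transpose b c \<circ> s"
  define k where "k = card (orbit s b)"
  have cA: "c \<in> A"
    using permutes_orbit_subset[OF s bA] funpow_in_orbit[OF permutes_self_in_orbit[OF s fin, of b]] c by blast
  have r: "r permutes A" unfolding r_def using s bA cA by (rule permutes_transpose_comp)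
  note m = transpose_split[OF s fin bA d c, folded r_def j_def k_def]
  have kdj: "k = d + j" "j > 0" using d by (auto simp: k_def j_def)
  have self: "x \<in> orbit r x" for x using permutes_self_in_orbit[OF r fin] .
  have size: "size (cycle_type A r) = Suc (size (cycle_type A s))"
    using arg_cong[OF m(1), of size] by simp
  have iff: "cycle_type A (transpose a b \<circ> r) = cycle_type A s \<longleftrightarrow> a \<notin> orbit r b \<and> card (orbit r a) = j"
    if a: "a \<in> A" "a \<noteq> b" for a
  proof (cases "a \<in> orbit r b")
    case True
    obtain e where e: "0 < e" "e < card (orbit r b)" "a = (r ^^ e) b"
      using orbit_obtain_power[OF r fin True a(2)] by metis
    have "size (cycle_type A (transpose a b \<circ> r)) = Suc (size (cycle_type A r))"
      using arg_cong[OF transpose_split(1)[OF r fin bA e], of size] by (simp add: transpose_commute)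
    hence "size (cycle_type A s) < size (cycle_type A (transpose a b \<circ> r))" using size by linarith
    thus ?thesis using True by (metis less_irrefl)
  next
    case False
    define T where "T = cycle_type A (transpose a b \<circ> r)"
    have T: "add_mset (d + card (orbit r a)) (cycle_type A r) = add_mset d (add_mset (card (orbit r a)) T)"
      using transpose_merge(1)[OF r fin bA a(1) False] m(2) by (simp add: T_def transpose_commute)
    have "T = cycle_type A s \<longleftrightarrow> card (orbit r a) = j"
    proof
      assume "card (orbit r a) = j"
      thus "T = cycle_type A s" using T m(1) kdj by simp
    next
      assume "T = cycle_type A s"
      hence "add_mset (d + j) (add_mset d (add_mset (card (orbit r a)) T))
          = add_mset (d + card (orbit r a)) (add_mset d (add_mset j T))"
        using T m(1) kdj by (metis add_mset_commute)
      hence "add_mset (d + j) (add_mset (card (orbit r a)) T) = add_mset (d + card (orbit r a)) (add_mset j T)"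
        by (simp add: add_mset_commute[of _ d])
      hence "d + j = d + card (orbit r a) \<and> card (orbit r a) = j \<or> d + j = j \<and> card (orbit r a) = d + card (orbit r a)"
        unfolding add_mset_pair_eq_iff .
      \<comment> \<open>The other alternative would force d = 0.\<close>
      thus "card (orbit r a) = j" using d(1) by linarith
    qed
    thus ?thesis using False by (simp add: T_def)
  qed
  let ?E = "{a \<in> A. card (orbit r a) = j}"
  have "{a \<in> A. a \<noteq> b \<and> a \<noteq> c \<and> cycle_type A (transpose a b \<circ> r) = cycle_type A s}
      = {a \<in> ?E. a \<notin> orbit r b} - {c}"
    using iff self by auto
  moreover have "c \<in> {a \<in> ?E. a \<notin> orbit r b}" using cA m by simp
  ultimately have "card {a \<in> A. a \<noteq> b \<and> a \<noteq> c \<and> cycle_type A (transpose a b \<circ> r) = cycle_type A s}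
      = card {a \<in> ?E. a \<notin> orbit r b} - 1"
    using fin by (simp add: card_Diff_singleton)
  moreover have "card {a \<in> ?E. a \<notin> orbit r b} = j * (1 + count (cycle_type A s) j)"
  proof -
    \<comment> \<open>If d = j, the piece of \<open>b\<close> is one more cycle of length j in
      \<open>r\<close>. Its points are excluded, which offsets the additional part, so both cases
      give the same number.\<close>
    have in_orbit: "{a \<in> ?E. a \<in> orbit r b} = (if d = j then orbit r b else {})"
      using permutes_orbit_subset[OF r bA] permutes_orbit_eq[OF r fin] m(2) by auto
    have "card ?E = card {a \<in> ?E. a \<in> orbit r b} + card {a \<in> ?E. a \<notin> orbit r b}"
      using fin by (subst card_Un_disjoint[symmetric]) (auto intro: arg_cong[where f = card])
    moreover have "card {a \<in> ?E. a \<in> orbit r b} = (if d = j then j else 0)"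
      unfolding in_orbit using m(2) by simp
    moreover have "card ?E = j * count (cycle_type A r) j"
      by (rule card_orbit_size_eq[OF r fin])
    moreover have "count (cycle_type A r) j = (if d = j then 1 else 0) + 1 + count (cycle_type A s) j"
      using arg_cong[OF m(1), of "\<lambda>M. count M j"] kdj d by (auto split: if_splits)
    ultimately show ?thesis by (auto simp: algebra_simps split: if_splits)
  qed
  ultimately show ?thesis by (simp add: r_def)
qed

lemma sum_by_orbit_size:
  fixes g :: "nat \<Rightarrow> real"
  assumes "p permutes A" "finite A"
  shows "(\<Sum>b\<in>A. g (card (orbit p b))) = (\<Sum>k = 1..card A. real k * real (count (cycle_type A p) k) * g k)"
proof -
  have "card (orbit p b) \<in> {1..card A}" if "b \<in> A" for b
    using permutes_orbit_subset[OF assms(1) that] assms(2) orbit_nonempty[of p b]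
    by (auto simp: Suc_le_eq card_gt_0_iff intro: finite_subset card_mono)
  hence "(\<Sum>b\<in>A. g (card (orbit p b))) = (\<Sum>k = 1..card A. \<Sum>b | b \<in> A \<and> card (orbit p b) = k. g (card (orbit p b)))"
    by (intro sum.group[symmetric]) (use assms(2) in auto)
  also have "\<dots> = (\<Sum>k = 1..card A. real (card {b \<in> A. card (orbit p b) = k}) * g k)"
    by (intro sum.cong refl) simp
  finally show ?thesis by (simp add: card_orbit_size_eq[OF assms])
qed

text \<open>Choose \<open>b\<close>, then \<open>c\<close>, then \<open>a\<close>: the two preceding
  lemmas on the third point count the \<open>a\<close>, according to whether \<open>c\<close> lies
  on the cycle of \<open>b\<close>. Ordered triples are counted, so each 3-cycle appears in its
  three rotations.\<close>

lemma card_three_cycles_preserving_cycle_type: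
  assumes s: "s permutes A" and fin: "finite A"
  shows "real (card {(a, b, c). a \<in> A \<and> b \<in> A \<and> c \<in> A \<and> distinct [a, b, c] \<and>
            cycle_type A (transpose a b \<circ> (transpose b c \<circ> s)) = cycle_type A s})
       = three_cycle_weight (card A) (cycle_type A s)"
proof -
  define n M where "n = card A" and "M = cycle_type A s"
  \<comment> \<open>This is the number of points on cycles of length k.\<close>
  define w where "w k = real k * real (count M k)" for k
  define F where "F b c = {a \<in> A. a \<noteq> b \<and> a \<noteq> c \<and>
      cycle_type A (transpose a b \<circ> (transpose b c \<circ> s)) = cycle_type A s}" for b c
  \<comment> \<open>The number of pairs (c, a) for a point \<open>b\<close> on a cycle of length k:
    the first sum comes from \<open>c\<close> on other cycles, the bracket from \<open>c\<close> on
    the same cycle.\<close>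
  define g where "g k = (\<Sum>l\<in>{1..n} - {k}. w l) + ((real k - 1) * (real k - 2) / 2 + (\<Sum>l\<in>{1..<k}. w l))" for k
  have finF: "finite (F b c)" for b c using fin by (simp add: F_def)
  have "card {(a, b, c). a \<in> A \<and> b \<in> A \<and> c \<in> A \<and> distinct [a, b, c] \<and>
            cycle_type A (transpose a b \<circ> (transpose b c \<circ> s)) = cycle_type A s}
      = card (SIGMA b:A. SIGMA c:A - {b}. F b c)"
    by (rule bij_betw_same_card[where f = "\<lambda>(a, b, c). (b, c, a)"],
        rule bij_betwI[where g = "\<lambda>(b, c, a). (a, b, c)"]) (auto simp: F_def)
  also have "\<dots> = (\<Sum>b\<in>A. \<Sum>c\<in>A - {b}. card (F b c))"
    using fin finF by (simp add: card_SigmaI)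
  finally have "real (card {(a, b, c). a \<in> A \<and> b \<in> A \<and> c \<in> A \<and> distinct [a, b, c] \<and>
            cycle_type A (transpose a b \<circ> (transpose b c \<circ> s)) = cycle_type A s})
      = (\<Sum>b\<in>A. \<Sum>c\<in>A - {b}. real (card (F b c)))"
    by simp
  also have "\<dots> = (\<Sum>b\<in>A. g (card (orbit s b)))"
  proof (rule sum.cong[OF refl])
    fix b assume b: "b \<in> A"
    define k where "k = card (orbit s b)"
    have sub: "orbit s b \<subseteq> A" using permutes_orbit_subset[OF s b] .
    have bb: "b \<in> orbit s b" using permutes_self_in_orbit[OF s fin] .
    have k: "1 \<le> k" using finite_orbit[OF bb] orbit_nonempty[of s b] by (simp add: k_def Suc_le_eq card_gt_0_iff)
    have "A - {b} = (A - orbit s b) \<union> (orbit s b - {b})" using sub bb by auto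
    hence "(\<Sum>c\<in>A - {b}. real (card (F b c)))
        = (\<Sum>c\<in>A - orbit s b. real (card (F b c))) + (\<Sum>c\<in>orbit s b - {b}. real (card (F b c)))"
      using fin sub by (simp only:) (rule sum.union_disjoint, auto intro: finite_subset)
    moreover have "(\<Sum>c\<in>A - orbit s b. real (card (F b c))) = (\<Sum>l\<in>{1..n} - {k}. w l)"
    proof -
      have "(\<Sum>c\<in>A - orbit s b. real (card (F b c))) = (\<Sum>c\<in>A - orbit s b. of_bool (card (orbit s c) \<noteq> k))"
        by (intro sum.cong refl)
          (use card_third_point_merge[OF s fin b] in \<open>auto simp: F_def k_def\<close>)
      \<comment> \<open>The points added to the range lie on the cycle of \<open>b\<close>, have
        orbit size \<open>k\<close>, and contribute zero.\<close>
      also have "\<dots> = (\<Sum>c\<in>A. of_bool (card (orbit s c) \<noteq> k))"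
        by (rule sum.mono_neutral_left) (use fin permutes_orbit_eq[OF s fin] in \<open>auto simp: k_def\<close>)
      also have "\<dots> = (\<Sum>l = 1..n. w l * of_bool (l \<noteq> k))"
        unfolding n_def w_def M_def using sum_by_orbit_size[OF s fin, of "\<lambda>l. of_bool (l \<noteq> k)"] by simp
      also have "\<dots> = (\<Sum>l\<in>{1..n} - {k}. w l)"
        by (rule sum.mono_neutral_cong_right) auto
      finally show ?thesis .
    qed
    moreover have "(\<Sum>c\<in>orbit s b - {b}. real (card (F b c)))
        = (real k - 1) * (real k - 2) / 2 + (\<Sum>l\<in>{1..<k}. w l)"
    proof -
      have bij: "bij_betw (\<lambda>i. (s ^^ i) b) {..<k} (orbit s b)"
        using orbit_coordinates(1)[OF bb] by (simp add: k_def)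
      hence "bij_betw (\<lambda>i. (s ^^ i) b) ({..<k} - {0}) (orbit s b - {b})"
        using k bij_betw_DiffI[of "\<lambda>i. (s ^^ i) b" "{..<k}" "orbit s b" "{0}" "{b}"]
        by (simp add: bij_betw_def bb)
      moreover have "{..<k} - {0} = {1..<k}" by auto
      ultimately have "bij_betw (\<lambda>i. (s ^^ i) b) {1..<k} (orbit s b - {b})" by simp
      hence "(\<Sum>c\<in>orbit s b - {b}. real (card (F b c))) = (\<Sum>d\<in>{1..<k}. real (card (F b ((s ^^ d) b))))"
        by (rule sum.reindex_bij_betw[symmetric])
      also have "\<dots> = (\<Sum>d\<in>{1..<k}. (real (k - d) - 1) + w (k - d))"
      proof (rule sum.cong[OF refl])
        fix d assume d: "d \<in> {1..<k}"
        hence "real (card (F b ((s ^^ d) b))) = real ((k - d) * (1 + count M (k - d)) - 1)"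
          unfolding F_def M_def k_def using card_third_point_split[OF s fin b, of d] by simp
        \<comment> \<open>The product is positive because d < k, so the subtraction is not
          truncated.\<close>
        also have "\<dots> = real ((k - d) * (1 + count M (k - d))) - 1"
          using d by (subst of_nat_diff) auto
        finally show "real (card (F b ((s ^^ d) b))) = (real (k - d) - 1) + w (k - d)"
          by (simp add: w_def distrib_left)
      qed
      also have "\<dots> = (\<Sum>j\<in>{1..<k}. (real j - 1) + w j)"
        by (rule sum.reindex_bij_witness[where i = "\<lambda>j. k - j" and j = "\<lambda>j. k - j"]) auto
      also have "\<dots> = (\<Sum>j\<in>{1..<k}. real j - 1) + (\<Sum>l\<in>{1..<k}. w l)"
        by (rule sum.distrib)
      also have "(\<Sum>j\<in>{1..<k}. real j - 1) = (real k - 1) * (real k - 2) / 2"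
        using k by (induction k rule: dec_induct) (auto simp: field_simps)
      finally show ?thesis .
    qed
    ultimately show "(\<Sum>c\<in>A - {b}. real (card (F b c))) = g (card (orbit s b))"
      unfolding g_def k_def by simp
  qed
  also have "\<dots> = (\<Sum>k = 1..n. w k * g k)"
    unfolding n_def w_def M_def by (rule sum_by_orbit_size[OF s fin])
  also have "\<dots> = three_cycle_weight n M"
  proof -
    let ?L = "{(k,l). k \<in> {1..n} \<and> l \<in> {1..n} \<and> l < k}"
    let ?U = "{(k,l). k \<in> {1..n} \<and> l \<in> {1..n} \<and> k < l}"
    have fins: "finite ?L" "finite ?U" by (rule finite_subset[of _ "{1..n} \<times> {1..n}"], auto)+
    have below: "(\<Sum>k = 1..n. \<Sum>l\<in>{1..<k}. w k * w l) = (\<Sum>(k,l)\<in>?L. w k * w l)"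
      by (subst sum.Sigma) (auto intro!: sum.cong)
    have "(\<Sum>k = 1..n. \<Sum>l\<in>{1..n} - {k}. w k * w l) = (\<Sum>(k,l)\<in>?L \<union> ?U. w k * w l)"
      by (subst sum.Sigma) (auto intro!: sum.cong)
    also have "\<dots> = (\<Sum>(k,l)\<in>?L. w k * w l) + (\<Sum>(k,l)\<in>?U. w k * w l)"
      by (rule sum.union_disjoint) (use fins in auto)
    also have "(\<Sum>(k,l)\<in>?U. w k * w l) = (\<Sum>(k,l)\<in>?L. w k * w l)"
      by (rule sum.reindex_bij_witness[where i = "\<lambda>(k,l). (l,k)" and j = "\<lambda>(k,l). (l,k)"]) auto
    finally have off: "(\<Sum>k = 1..n. \<Sum>l\<in>{1..n} - {k}. w k * w l) = 2 * (\<Sum>(k,l)\<in>?L. w k * w l)" by simp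
    \<comment> \<open>Each unordered pair of different lengths arises twice from joining first and
      once from cutting first, whence the factor 3 in \<open>three_cycle_weight\<close>.\<close>
    have "(\<Sum>k = 1..n. w k * g k) = (\<Sum>k = 1..n. \<Sum>l\<in>{1..n} - {k}. w k * w l)
        + ((\<Sum>k = 1..n. w k * ((real k - 1) * (real k - 2) / 2)) + (\<Sum>k = 1..n. \<Sum>l\<in>{1..<k}. w k * w l))"
      unfolding g_def distrib_left sum.distrib sum_distrib_left ..
    also have "(\<Sum>k = 1..n. w k * ((real k - 1) * (real k - 2) / 2))
        = (\<Sum>k = 1..n. (real k * (real k - 1) * (real k - 2) / 2) * real (count M k))"
      by (intro sum.cong refl) (simp add: w_def)
    finally show ?thesis
      unfolding off below three_cycle_weight_def by (simp add: w_def)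
  qed
  finally show ?thesis unfolding n_def M_def .
qed

section \<open>Cycle types and conjugacy\<close>

text \<open>These are the \<open>t\<close> conjugating \<open>p\<close> to \<open>q\<close>, written
  without inverses. For q = p this is the centraliser of \<open>p\<close>.\<close>

definition intertwiners :: "'a set \<Rightarrow> ('a \<Rightarrow> 'a) \<Rightarrow> ('a \<Rightarrow> 'a) \<Rightarrow> ('a \<Rightarrow> 'a) set" where
  "intertwiners A p q = {t. t permutes A \<and> t \<circ> p = q \<circ> t}"

text \<open>An intertwiner carries the orbits of \<open>p\<close> bijectively onto those of
  \<open>q\<close>, preserving sizes.\<close>

lemma cycle_type_intertwiner:
  assumes p: "p permutes A" and fin: "finite A" and t: "t \<in> intertwiners A p q"
  shows "cycle_type A q = cycle_type A p"
proof -
  have tA: "t permutes A" and tp: "t (p x) = q (t x)" for x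
    using t by (auto simp: intertwiners_def fun_eq_iff)
  have inj: "inj t" using tA by (rule permutes_inj)
  have pow: "(q ^^ i) (t x) = t ((p ^^ i) x)" for i x
    by (induction i) (auto simp: tp)
  have "orbit q (t x) = t ` orbit p x" for x
    unfolding orbit_altdef by (auto simp: pow)
  hence "orbit q ` (t ` A) = (`) t ` (orbit p ` A)" by (simp add: image_image)
  hence "cycle_type A q = image_mset card (mset_set ((`) t ` (orbit p ` A)))"
    by (simp add: cycle_type_def permutes_image[OF tA])
  also have "mset_set ((`) t ` (orbit p ` A)) = image_mset ((`) t) (mset_set (orbit p ` A))"
    by (rule image_mset_mset_set[symmetric]) (use inj in \<open>auto simp: inj_on_def inj_image_eq_iff\<close>)
  also have "image_mset card \<dots> = cycle_type A p"
    using inj by (simp add: cycle_type_def multiset.map_comp comp_def card_image inj_on_subset)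
  finally show ?thesis .
qed

text \<open>Match points with equal coordinates, p^i x with q^i y. Equal lengths make the closing
  steps of both cycles agree.\<close>

lemma orbit_intertwining_bij:
  assumes "x \<in> orbit p x" "y \<in> orbit q y" "card (orbit p x) = card (orbit q y)"
  obtains h where "bij_betw h (orbit p x) (orbit q y)" "\<And>z. z \<in> orbit p x \<Longrightarrow> h (p z) = q (h z)"
proof
  define k where "k = card (orbit p x)"
  have P: "bij_betw (\<lambda>i. (p ^^ i) x) {..<k} (orbit p x)" "(p ^^ k) x = x"
    and Q: "bij_betw (\<lambda>i. (q ^^ i) y) {..<k} (orbit q y)" "(q ^^ k) y = y"
    using orbit_coordinates[OF assms(1)] orbit_coordinates[OF assms(2)] assms(3) by (simp_all add: k_def)
  define e where "e = the_inv_into {..<k} (\<lambda>i. (p ^^ i) x)"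
  define h where "h z = (q ^^ e z) y" for z
  have inj: "inj_on (\<lambda>i. (p ^^ i) x) {..<k}" using P by (simp add: bij_betw_def)
  have e: "e ((p ^^ i) x) = i" if "i < k" for i
    unfolding e_def using the_inv_into_f_f[OF inj, of i] that by simp
  have "bij_betw ((\<lambda>i. (q ^^ i) y) \<circ> e) (orbit p x) (orbit q y)"
    unfolding e_def using bij_betw_the_inv_into[OF P(1)] Q(1) by (rule bij_betw_trans)
  thus "bij_betw h (orbit p x) (orbit q y)" by (simp add: h_def[abs_def] comp_def)
  fix z assume "z \<in> orbit p x"
  then obtain i where i: "i < k" "z = (p ^^ i) x" using P(1) by (auto simp: bij_betw_def)
  show "h (p z) = q (h z)"
  proof (cases "Suc i < k")
    case True
    have "p z = (p ^^ Suc i) x" by (simp add: i)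
    thus ?thesis using e[OF i(1)] e[OF True] by (simp add: h_def i(2))
  next
    case False
    hence k: "k = Suc i" using i by simp
    hence "p z = (p ^^ 0) x" using P(2) i by simp
    hence "h (p z) = y" using e[of 0] k by (simp add: h_def)
    also have "y = q (h z)" using Q(2) e[OF i(1)] k by (simp add: h_def i(2))
    finally show ?thesis .
  qed
qed

lemma cycle_type_remove_orbit:
  assumes p: "p permutes A" and fin: "finite A" and x: "x \<in> A"
  defines "A' \<equiv> A - orbit p x"
  shows "perm_restrict p A' permutes A'"
    and "cycle_type A p = add_mset (card (orbit p x)) (cycle_type A' (perm_restrict p A'))"
proof -
  have self: "z \<in> orbit p z" for z using permutes_self_in_orbit[OF p fin] .
  have cyc: "cyclic_on p (orbit p x)" using p fin by (rule cyclic_on_orbit)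
  show "perm_restrict p A' permutes A'"
    unfolding A'_def using p cyc by (rule perm_restrict_diff_cyclic)
  have dis: "orbit p z \<inter> orbit p x = {}" if "z \<notin> orbit p x" for z
  proof -
    have "orbit p z \<noteq> orbit p x" using that self by auto
    thus ?thesis
      using pairwiseD[OF permutes_pairwise_disjnt_orbits[OF p fin], of "orbit p z" "orbit p x"]
      by (simp add: disjnt_def)
  qed
  have "orbit (perm_restrict p A') z = orbit p z" if "z \<in> A'" for z
  proof (rule orbit_cong[OF self])
    fix y assume "y \<in> orbit p z"
    hence "y \<in> A'" using that dis permutes_orbit_subset[OF p, of z] unfolding A'_def by blast
    thus "perm_restrict p A' y = p y" by (simp add: perm_restrict_def)
  qed
  hence img: "orbit (perm_restrict p A') ` A' = orbit p ` A'" by (rule image_cong[OF refl])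
  have "A = A' \<union> orbit p x" using permutes_orbit_subset[OF p x] by (auto simp: A'_def)
  hence "orbit p ` A = orbit p ` A' \<union> orbit p ` orbit p x" by (simp only: image_Un)
  also have "orbit p ` orbit p x = {orbit p x}"
    using permutes_orbit_eq[OF p fin] self[of x] by blast
  finally have "orbit p ` A = insert (orbit p x) (orbit p ` A')" by simp
  moreover have "orbit p x \<notin> orbit p ` A'" using self by (auto simp: A'_def)
  ultimately show "cycle_type A p = add_mset (card (orbit p x)) (cycle_type A' (perm_restrict p A'))"
    unfolding cycle_type_def img using fin by (simp add: A'_def)
qed

text \<open>Remove a cycle of the same length from both sides, match the two removed cycles, and
  glue with the matching of the rest. Two sets are needed for the induction: even if A = B, the
  remaining sets may differ.\<close>

lemma cycle_type_eq_imp_intertwining_bij: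
  assumes "finite A" "finite B" "p permutes A" "q permutes B" "cycle_type A p = cycle_type B q"
  shows "\<exists>g. bij_betw g A B \<and> (\<forall>x\<in>A. g (p x) = q (g x))"
  using assms
proof (induction "card A" arbitrary: A B p q rule: less_induct)
  case less
  note fin = \<open>finite A\<close> \<open>finite B\<close> and p = \<open>p permutes A\<close> and q = \<open>q permutes B\<close>
  show ?case
  proof (cases "A = {}")
    case True
    hence "card B = 0"
      using cycle_type_parts(2)[OF q fin(2)] less.prems(5) by (simp add: cycle_type_def)
    hence "B = {}" using fin by simp
    thus ?thesis using True by (simp add: bij_betw_def)
  next
    case False
    then obtain x where x: "x \<in> A" by auto
    have xx: "x \<in> orbit p x" using permutes_self_in_orbit[OF p fin(1)] .
    define A' where "A' = A - orbit p x"
    note rA = cycle_type_remove_orbit[OF p fin(1) x, folded A'_def]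
    have "card (orbit p x) \<in># cycle_type B q" using rA(2) less.prems(5) by simp
    then obtain y where y: "y \<in> B" "card (orbit q y) = card (orbit p x)"
      using fin by (auto simp: cycle_type_def)
    have yy: "y \<in> orbit q y" using permutes_self_in_orbit[OF q fin(2)] .
    define B' where "B' = B - orbit q y"
    note rB = cycle_type_remove_orbit[OF q fin(2) y(1), folded B'_def]
    have "A' \<subset> A" using x xx by (auto simp: A'_def)
    hence "card A' < card A" using fin by (intro psubset_card_mono)
    moreover have "cycle_type A' (perm_restrict p A') = cycle_type B' (perm_restrict q B')"
      using rA(2) rB(2) less.prems(5) y(2) by simp
    ultimately obtain g where g: "bij_betw g A' B'"
      and "\<forall>x\<in>A'. g (perm_restrict p A' x) = perm_restrict q B' (g x)"
      using less.hyps[OF _ _ _ rA(1) rB(1)] fin by (auto simp: A'_def B'_def)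
    hence gpq: "g (p z) = q (g z)" if "z \<in> A'" for z
      using that bij_betwE[OF g] by (simp add: perm_restrict_def)
    obtain h where h: "bij_betw h (orbit p x) (orbit q y)" and hpq: "\<And>z. z \<in> orbit p x \<Longrightarrow> h (p z) = q (h z)"
      using orbit_intertwining_bij[OF xx yy] y(2) by metis
    define f where "f z = (if z \<in> orbit p x then h z else g z)" for z
    have sub: "orbit p x \<subseteq> A" "orbit q y \<subseteq> B"
      using permutes_orbit_subset p q x y(1) by metis+
    have "bij_betw f (orbit p x \<union> A') (orbit q y \<union> B')"
    proof (rule bij_betw_combine)
      show "bij_betw f (orbit p x) (orbit q y)" using h by (rule bij_betw_cong[THEN iffD1, rotated]) (simp add: f_def)
      show "bij_betw f A' B'" using g by (rule bij_betw_cong[THEN iffD1, rotated]) (simp add: f_def A'_def)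
    qed (auto simp: B'_def)
    moreover have "orbit p x \<union> A' = A" "orbit q y \<union> B' = B" using sub by (auto simp: A'_def B'_def)
    moreover have "f (p z) = q (f z)" if "z \<in> A" for z
    proof (cases "z \<in> orbit p x")
      case True
      thus ?thesis using hpq orbit.step[OF True] by (simp add: f_def)
    next
      case False
      hence zA: "z \<in> A'" using that by (simp add: A'_def)
      have "p z \<in> A'"
        using permutes_in_image[OF rA(1), of z] zA by (simp add: perm_restrict_def)
      thus ?thesis using gpq[OF zA] False by (simp add: f_def A'_def)
    qed
    ultimately show ?thesis by auto
  qed
qed

lemma intertwiners_nonempty_iff:
  assumes "finite A" "p permutes A" "q permutes A"
  shows "intertwiners A p q \<noteq> {} \<longleftrightarrow> cycle_type A p = cycle_type A q"
proof
  assume "cycle_type A p = cycle_type A q"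
  then obtain g where g: "bij_betw g A A" "\<And>x. x \<in> A \<Longrightarrow> g (p x) = q (g x)"
    using cycle_type_eq_imp_intertwining_bij[OF assms(1,1,2,3)] by blast
  \<comment> \<open>The bijection of \<open>A\<close> is extended by the identity, as
    \<open>permutes\<close> demands.\<close>
  define t where "t x = (if x \<in> A then g x else x)" for x
  have "t permutes A"
    by (rule bij_imp_permutes) (use g(1) in \<open>auto simp: t_def cong: bij_betw_cong\<close>)
  moreover have "t (p x) = q (t x)" for x
    using g(2) permutes_in_image[OF assms(2)] permutes_not_in[OF assms(2)] permutes_not_in[OF assms(3)]
    by (auto simp: t_def)
  ultimately have "t \<in> intertwiners A p q" by (auto simp: intertwiners_def)
  thus "intertwiners A p q \<noteq> {}" by blast
qed (use cycle_type_intertwiner[OF assms(2,1)] in auto)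

section \<open>Counting conjugating permutations\<close>

lemma inv_intertwiner:
  assumes "g \<in> intertwiners A p q" shows "inv g \<in> intertwiners A q p"
proof -
  have g: "g permutes A" and "\<And>x. g (p x) = q (g x)" using assms by (auto simp: intertwiners_def fun_eq_iff)
  hence "inv g (q x) = p (inv g x)" for x by (metis permutes_inverses)
  thus ?thesis using permutes_inv[OF g] by (auto simp: intertwiners_def)
qed

lemma comp_intertwiner:
  assumes "t \<in> intertwiners A p q" "u \<in> intertwiners A q r" shows "u \<circ> t \<in> intertwiners A p r"
  using assms permutes_compose[of t A u] by (auto simp: intertwiners_def fun_eq_iff)

text \<open>Composing with the inverse of one fixed intertwiner, on the left or on the right,
  identifies the set with the centraliser of \<open>p\<close> or of \<open>q\<close>.\<close>

lemma card_intertwiners: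
  assumes fin: "finite A" and p: "p permutes A" and q: "q permutes A" and "cycle_type A p = cycle_type A q"
  shows "card (intertwiners A p q) = card (intertwiners A p p)"
    and "card (intertwiners A p q) = card (intertwiners A q q)"
proof -
  obtain g where g: "g \<in> intertwiners A p q"
    using assms intertwiners_nonempty_iff[OF fin p q] by blast
  hence gA: "g permutes A" by (simp add: intertwiners_def)
  have "bij_betw ((\<circ>) (inv g)) (intertwiners A p q) (intertwiners A p p)"
    by (rule bij_betwI[where g = "(\<circ>) g"])
      (use g inv_intertwiner[OF g] permutes_inv_o[OF gA] in
        \<open>auto intro: comp_intertwiner simp flip: comp_assoc\<close>)
  thus "card (intertwiners A p q) = card (intertwiners A p p)" by (rule bij_betw_same_card)
  have "bij_betw (\<lambda>t. t \<circ> inv g) (intertwiners A p q) (intertwiners A q q)"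
    by (rule bij_betwI[where g = "\<lambda>t. t \<circ> g"])
      (use g inv_intertwiner[OF g] permutes_inv_o[OF gA] in
        \<open>auto intro: comp_intertwiner simp: comp_assoc\<close>)
  thus "card (intertwiners A p q) = card (intertwiners A q q)" by (rule bij_betw_same_card)
qed

lemma partition_all_ones:
  assumes "M \<in> partitions_of n" "\<forall>k\<in>#M. k = 1" shows "M = replicate_mset n 1"
proof -
  have M: "M = replicate_mset (size M) 1" using assms(2) by (induction M) auto
  hence "sum_mset M = size M" by (metis sum_mset_replicate_mset mult.right_neutral of_nat_id)
  thus ?thesis using M assms(1) by (auto simp: partitions_of_def)
qed

text \<open>Start from the identity and lengthen cycles one point at a time: a part k > 1 is
  obtained by joining a cycle of length k - 1 to a fixed point. Replacing k by k - 1 and 1 adds a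
  part, so the induction is on \<open>card A - size M\<close>.\<close>

lemma ex_permutation_of_cycle_type:
  assumes "finite A" "M \<in> partitions_of (card A)"
  shows "\<exists>p. p permutes A \<and> cycle_type A p = M"
  using assms(2)
proof (induction "card A - size M" arbitrary: M rule: less_induct)
  case less
  show ?case
  proof (cases "\<forall>k\<in>#M. k = 1")
    case True
    have "orbit id x = {x}" for x :: 'a by (simp add: orbit_eq_singleton_iff)
    hence "\<forall>k\<in>#cycle_type A id. k = 1" using assms(1) by (auto simp: cycle_type_def)
    moreover have "cycle_type A id \<in> partitions_of (card A)"
      by (rule cycle_type_partitions_of[OF permutes_id assms(1)])
    ultimately have "cycle_type A id = M"
      using partition_all_ones[OF less.prems True] partition_all_ones[of "cycle_type A id"] by simp
    thus ?thesis using permutes_id by blast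
  next
    case False
    then obtain k N where kN: "M = add_mset k N" "k \<noteq> 1" by (auto dest: multi_member_split)
    have k: "k \<ge> 2" using less.prems kN by (auto simp: partitions_of_def)
    define M' where "M' = add_mset (k - 1) (add_mset 1 N)"
    have M': "M' \<in> partitions_of (card A)" using less.prems k by (auto simp: M'_def kN partitions_of_def)
    have "size M' = Suc (size M)" by (simp add: M'_def kN)
    moreover have "size M' \<le> card A" using size_le_sum_mset[of M'] M' by (simp add: partitions_of_def)
    ultimately obtain p where p: "p permutes A" "cycle_type A p = M'"
      using less.hyps[OF _ M'] by fastforce
    have count: "card {a \<in> A. card (orbit p a) = j} = j * count M' j" for j
      using card_orbit_size_eq[OF p(1) assms(1)] p(2) by simp
    have "card {a \<in> A. card (orbit p a) = 1} \<noteq> 0" unfolding count by (simp add: M'_def)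
    then obtain c where c: "c \<in> A" "card (orbit p c) = 1" by (metis (mono_tags, lifting) Collect_empty_eq card.empty)
    hence oc: "orbit p c = {c}"
      using permutes_self_in_orbit[OF p(1) assms(1), of c] by (auto simp: card_1_singleton_iff)
    \<comment> \<open>For k = 2 both cycles to be joined are fixed points, so a second one besides
      \<open>c\<close> is required.\<close>
    have "card ({a \<in> A. card (orbit p a) = k - 1} - {c}) \<noteq> 0"
    proof (cases "k = 2")
      case True
      have "card {a \<in> A. card (orbit p a) = k - 1} \<ge> 2" unfolding count by (simp add: M'_def True)
      thus ?thesis using card_Diff1_le[of "{a \<in> A. card (orbit p a) = k - 1}" c] by (auto simp: card_Diff_singleton_if split: if_splits)
    next
      case False
      hence "{a \<in> A. card (orbit p a) = k - 1} - {c} = {a \<in> A. card (orbit p a) = k - 1}" using c k by auto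
      moreover have "card {a \<in> A. card (orbit p a) = k - 1} \<noteq> 0" unfolding count using k by (simp add: M'_def)
      ultimately show ?thesis by simp
    qed
    then obtain b where b: "b \<in> A" "card (orbit p b) = k - 1" "b \<noteq> c"
      by (metis (mono_tags, lifting) DiffE all_not_in_conv card.empty mem_Collect_eq singletonI)
    have "c \<notin> orbit p b"
      using permutes_orbit_eq[OF p(1) assms(1), of c b] oc b(3) permutes_self_in_orbit[OF p(1) assms(1), of b] by auto
    from transpose_merge(1)[OF p(1) assms(1) b(1) c(1) this]
    have "cycle_type A (transpose b c \<circ> p) = M"
      using k by (simp add: b c p(2) M'_def kN add_mset_commute)
    thus ?thesis using permutes_transpose_comp[OF p(1) b(1) c(1)] by blast
  qed
qed

text \<open>Orbit-stabiliser in summed form: fix \<open>p\<close> of type \<open>M\<close> and sort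
  all \<open>t\<close> by the conjugate s = t p t^-1. The fibre over \<open>s\<close> is
  \<open>intertwiners A p s\<close>, as large as the centraliser of \<open>s\<close>.\<close>

lemma sum_card_centralizers:
  assumes fin: "finite A" and M: "M \<in> partitions_of (card A)"
  shows "(\<Sum>s | s permutes A \<and> cycle_type A s = M. card (intertwiners A s s)) = fact (card A)"
proof -
  obtain p where p: "p permutes A" "cycle_type A p = M"
    using ex_permutation_of_cycle_type[OF assms] by blast
  let ?K = "{s. s permutes A \<and> cycle_type A s = M}"
  have finK: "finite ?K" using finite_permutations[OF fin] by (rule finite_subset[rotated]) auto
  have finI: "finite (intertwiners A p s)" for s
    using finite_permutations[OF fin] by (rule finite_subset[rotated]) (auto simp: intertwiners_def)
  have conj: "t \<in> intertwiners A p (t \<circ> p \<circ> inv t) \<and> t \<circ> p \<circ> inv t \<in> ?K" if t: "t permutes A" for t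
  proof -
    have "t \<circ> p \<circ> inv t permutes A" using t p permutes_inv[OF t] by (intro permutes_compose)
    moreover have "t \<in> intertwiners A p (t \<circ> p \<circ> inv t)"
      using t permutes_inverses(2)[OF t] by (auto simp: intertwiners_def)
    moreover from this have "cycle_type A (t \<circ> p \<circ> inv t) = M"
      using cycle_type_intertwiner[OF p(1) fin] p(2) by metis
    ultimately show ?thesis by simp
  qed
  have "{t. t permutes A} = (\<Union>s\<in>?K. intertwiners A p s)"
  proof
    show "{t. t permutes A} \<subseteq> (\<Union>s\<in>?K. intertwiners A p s)" using conj by blast
    show "(\<Union>s\<in>?K. intertwiners A p s) \<subseteq> {t. t permutes A}" unfolding intertwiners_def by blast
  qed
  with card_permutations[OF refl fin] have "fact (card A) = card (\<Union>s\<in>?K. intertwiners A p s)"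
    by (simp only:)
  also have "\<dots> = (\<Sum>s\<in>?K. card (intertwiners A p s))"
  proof (rule card_UN_disjoint[OF finK])
    show "\<forall>s\<in>?K. \<forall>u\<in>?K. s \<noteq> u \<longrightarrow> intertwiners A p s \<inter> intertwiners A p u = {}"
    proof (intro ballI impI)
      fix s u :: "'a \<Rightarrow> 'a" assume "s \<noteq> u"
      then obtain x where x: "s x \<noteq> u x" by blast
      have False if "t \<in> intertwiners A p s" "t \<in> intertwiners A p u" for t
      proof -
        have "t permutes A" "s (t y) = u (t y)" for y
          using that by (auto simp: intertwiners_def fun_eq_iff)
        thus False using x by (metis permutes_inverses(1))
      qed
      thus "intertwiners A p s \<inter> intertwiners A p u = {}" by auto
    qed
  qed (use finI in auto)
  also have "\<dots> = (\<Sum>s\<in>?K. card (intertwiners A s s))"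
    by (rule sum.cong) (use card_intertwiners(2)[OF fin p(1)] p(2) in auto)
  finally show ?thesis by (rule sym)
qed

section \<open>Pairs whose commutator is a 3-cycle\<close>

lemma cycle_of_list_3_apply:
  assumes "distinct [c, b, a]"
  shows "cycle_of_list [c, b, a] v = (if v = c then b else if v = b then a else if v = a then c else v)"
  using assms by (auto simp: transpose_def)

text \<open>The entry \<open>c\<close> can be any of the three moved points, and then b = p c and a
  = p b are forced.\<close>

lemma card_representations_3cycle:
  assumes "is_3cycle p" "p permutes A"
  shows "card {(a, b, c). a \<in> A \<and> b \<in> A \<and> c \<in> A \<and> distinct [a, b, c] \<and> p = cycle_of_list [c, b, a]} = 3"
proof -
  obtain x y z where xyz: "distinct [x, y, z]" "p = cycle_of_list [x, y, z]"
    using assms(1) by (auto simp: is_3cycle_def)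
  have p: "p v = (if v = x then y else if v = y then z else if v = z then x else v)" for v
    unfolding xyz(2) by (rule cycle_of_list_3_apply[OF xyz(1)])
  have A: "x \<in> A" "y \<in> A" "z \<in> A"
    using xyz(1) p permutes_not_in[OF assms(2)] by (metis distinct_length_2_or_more)+
  have "{(a, b, c). a \<in> A \<and> b \<in> A \<and> c \<in> A \<and> distinct [a, b, c] \<and> p = cycle_of_list [c, b, a]}
      = {(z, y, x), (x, z, y), (y, x, z)}" (is "?L = ?R")
  proof (intro equalityI subsetI)
    fix q assume "q \<in> ?L"
    then obtain a b c where q: "q = (a, b, c)" and d: "distinct [c, b, a]" and pe: "p = cycle_of_list [c, b, a]"
      by auto
    have p': "p v = (if v = c then b else if v = b then a else if v = a then c else v)" for v
      unfolding pe by (rule cycle_of_list_3_apply[OF d])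
    have "p c = b" "p b = a" "p c \<noteq> c" using p' d by auto
    thus "q \<in> ?R" using p xyz(1) unfolding q by (auto split: if_splits)
  next
    have "p = cycle_of_list [x, y, z]" "p = cycle_of_list [y, z, x]" "p = cycle_of_list [z, x, y]"
      using xyz(1) by (auto simp: fun_eq_iff p cycle_of_list_3_apply simp del: cycle_of_list.simps)
    moreover fix q assume "q \<in> ?R"
    ultimately show "q \<in> ?L" using A xyz(1) by (auto simp del: cycle_of_list.simps)
  qed
  also have "card \<dots> = 3" using xyz(1) by auto
  finally show ?thesis .
qed

text \<open>With C the 3-cycle, s t s^-1 t^-1 = C means t s = C^-1 s t. The list is reversed so that
  C^-1 is (a b)(b c), the product studied above.\<close>

lemma perm_commutator_eq_iff:
  assumes "s permutes A" "t permutes A"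
  shows "perm_commutator s t = cycle_of_list [c, b, a]
     \<longleftrightarrow> t \<in> intertwiners A s (transpose a b \<circ> (transpose b c \<circ> s))"
proof -
  let ?C = "transpose c b \<circ> transpose b a"
  have "perm_commutator s t = cycle_of_list [c, b, a] \<longleftrightarrow> (\<forall>x. s (t (inv s (inv t x))) = ?C x)"
    by (simp add: perm_commutator_def fun_eq_iff)
  \<comment> \<open>Substitute t (s x) for x, which runs over all points.\<close>
  also have "\<dots> \<longleftrightarrow> (\<forall>x. s (t x) = ?C (t (s x)))"
    using permutes_inverses[OF assms(1)] permutes_inverses[OF assms(2)] by metis
  also have "\<dots> \<longleftrightarrow> (\<forall>x. t (s x) = transpose a b (transpose b c (s (t x))))"
    by (metis comp_apply transpose_commute transpose_involutory)
  finally show ?thesis using assms(2) by (simp add: intertwiners_def fun_eq_iff)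
qed

theorem mainTheorem12:
  fixes n :: nat
  assumes "n > 2"
  shows "real (card {(s, t). s permutes {1..n} \<and> t permutes {1..n} \<and>
                       is_3cycle (perm_commutator s t)})
         = 3 / 8 * ((\<Sum>k = 1..n. real (divisor_sigma 3 k) * real (partition_count (n - k)))
                    - 2 * (\<Sum>k = 1..n. real k * real (divisor_sigma 1 k) * real (partition_count (n - k)))
                    + real n * real (partition_count n)) * real (fact n)"
proof -
  define A where "A = {1..n}"
  have fin: "finite A" and cardA: "card A = n" by (simp_all add: A_def)
  define S where "S = {p. p permutes A}"
  have finS: "finite S" using finite_permutations[OF fin] by (simp add: S_def)
  define D where "D = {(a, b, c). a \<in> A \<and> b \<in> A \<and> c \<in> A \<and> distinct [a, b, c]}"
  have finD: "finite D" by (rule finite_subset[of _ "A \<times> A \<times> A"]) (auto simp: D_def fin)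
  define R where "R p = {(a, b, c). a \<in> A \<and> b \<in> A \<and> c \<in> A \<and> distinct [a, b, c] \<and> p = cycle_of_list [c, b, a]}"
    for p
  define \<tau> where "\<tau> s = (\<lambda>(a, b, c). transpose a b \<circ> (transpose b c \<circ> s))" for s :: "nat \<Rightarrow> nat"
  define B where "B = {(s, t). s permutes A \<and> t permutes A \<and> is_3cycle (perm_commutator s t)}"
  have finB: "finite B" by (rule finite_subset[of _ "S \<times> S"]) (auto simp: B_def S_def finS[unfolded S_def])
  have \<tau>: "\<tau> s q permutes A" if "s \<in> S" "q \<in> D" for s q
    using that by (auto simp: \<tau>_def S_def D_def intro!: permutes_transpose_comp)
  have R3: "card (R (perm_commutator s t)) = 3" if "(s, t) \<in> B" for s t
  proof -
    have "perm_commutator s t permutes A"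
      using that unfolding perm_commutator_def B_def by (auto intro!: permutes_compose permutes_inv)
    thus ?thesis using card_representations_3cycle[of "perm_commutator s t" A] that by (simp add: R_def B_def)
  qed
  \<comment> \<open>Each pair is weighted by the three ways of writing its commutator as a 3-cycle
    on an ordered triple.\<close>
  have "3 * card B = (\<Sum>(s, t)\<in>B. card (R (perm_commutator s t)))"
    using R3 by (simp add: case_prod_unfold)
  also have "\<dots> = card (SIGMA st:B. R (perm_commutator (fst st) (snd st)))"
    using finB finD by (subst card_SigmaI) (auto simp: case_prod_unfold R_def D_def intro: finite_subset[OF _ finD])
  \<comment> \<open>Change the order of choice: first \<open>s\<close> and the triple, then
    \<open>t\<close> among the permutations conjugating \<open>s\<close> to
    \<open>\<tau> s q\<close>.\<close>
  also have "\<dots> = card (SIGMA s:S. SIGMA q:D. intertwiners A s (\<tau> s q))"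
  proof (rule bij_betw_same_card[where f = "\<lambda>((s, t), q). (s, q, t)"], rule bij_betwI[where g = "\<lambda>(s, q, t). ((s, t), q)"])
    show "(\<lambda>((s, t), q). (s, q, t)) \<in> (SIGMA st:B. R (perm_commutator (fst st) (snd st)))
        \<rightarrow> (SIGMA s:S. SIGMA q:D. intertwiners A s (\<tau> s q))"
      using perm_commutator_eq_iff[of _ A]
      by (auto simp: B_def R_def S_def D_def \<tau>_def simp del: cycle_of_list.simps)
    show "(\<lambda>(s, q, t). ((s, t), q)) \<in> (SIGMA s:S. SIGMA q:D. intertwiners A s (\<tau> s q))
        \<rightarrow> (SIGMA st:B. R (perm_commutator (fst st) (snd st)))"
    proof
      fix x assume "x \<in> (SIGMA s:S. SIGMA q:D. intertwiners A s (\<tau> s q))"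
      then obtain s a b c t where x: "x = (s, (a, b, c), t)" and s: "s permutes A" and q: "(a, b, c) \<in> D"
        and t: "t \<in> intertwiners A s (transpose a b \<circ> (transpose b c \<circ> s))"
        by (auto simp: S_def \<tau>_def)
      have tA: "t permutes A" using t by (simp add: intertwiners_def)
      have eq: "perm_commutator s t = cycle_of_list [c, b, a]" using perm_commutator_eq_iff[OF s tA] t by blast
      moreover have "distinct [c, b, a]" using q by (auto simp: D_def)
      ultimately have "is_3cycle (perm_commutator s t)" unfolding is_3cycle_def by blast
      thus "(case x of (s, q, t) \<Rightarrow> ((s, t), q)) \<in> (SIGMA st:B. R (perm_commutator (fst st) (snd st)))"
        using s tA q eq by (simp add: x B_def R_def D_def del: cycle_of_list.simps)
    qed
  qed auto
  also have "\<dots> = (\<Sum>s\<in>S. \<Sum>q\<in>D. card (intertwiners A s (\<tau> s q)))"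
  proof -
    have "finite (intertwiners A s u)" for s u
      by (rule finite_subset[OF _ finS]) (auto simp: intertwiners_def S_def)
    thus ?thesis using finS finD by (simp add: card_SigmaI)
  qed
  \<comment> \<open>There are no such \<open>t\<close> unless the cycle types agree, and then as
    many as the centraliser of \<open>s\<close> has elements.\<close>
  also have "\<dots> = (\<Sum>s\<in>S. card (intertwiners A s s) * card {q \<in> D. cycle_type A (\<tau> s q) = cycle_type A s})"
  proof (rule sum.cong[OF refl])
    fix s assume s: "s \<in> S"
    have "(\<Sum>q\<in>D. card (intertwiners A s (\<tau> s q)))
        = (\<Sum>q\<in>D. if cycle_type A (\<tau> s q) = cycle_type A s then card (intertwiners A s s) else 0)"
    proof (rule sum.cong[OF refl])
      fix q assume q: "q \<in> D"
      show "card (intertwiners A s (\<tau> s q))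
          = (if cycle_type A (\<tau> s q) = cycle_type A s then card (intertwiners A s s) else 0)"
      proof (cases "cycle_type A (\<tau> s q) = cycle_type A s")
        case True
        thus ?thesis using card_intertwiners(1)[OF fin _ \<tau>[OF s q]] s by (simp add: S_def)
      next
        case False
        hence "intertwiners A s (\<tau> s q) = {}"
          using intertwiners_nonempty_iff[OF fin _ \<tau>[OF s q], of s] s by (simp add: S_def)
        thus ?thesis using False by simp
      qed
    qed
    thus "(\<Sum>q\<in>D. card (intertwiners A s (\<tau> s q)))
        = card (intertwiners A s s) * card {q \<in> D. cycle_type A (\<tau> s q) = cycle_type A s}"
      using finD by (simp add: sum.If_cases Int_def mult.commute)
  qed
  finally have "3 * real (card B)
      = (\<Sum>s\<in>S. real (card (intertwiners A s s)) * real (card {q \<in> D. cycle_type A (\<tau> s q) = cycle_type A s}))"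
    by (metis (mono_tags, lifting) of_nat_mult of_nat_numeral of_nat_sum sum.cong)
  also have "\<dots> = (\<Sum>s\<in>S. real (card (intertwiners A s s)) * three_cycle_weight n (cycle_type A s))"
  proof (rule sum.cong[OF refl])
    fix s assume s: "s \<in> S"
    have "{q \<in> D. cycle_type A (\<tau> s q) = cycle_type A s}
      = {(a, b, c). a \<in> A \<and> b \<in> A \<and> c \<in> A \<and> distinct [a, b, c] \<and>
            cycle_type A (transpose a b \<circ> (transpose b c \<circ> s)) = cycle_type A s}"
      by (auto simp: D_def \<tau>_def)
    thus "real (card (intertwiners A s s)) * real (card {q \<in> D. cycle_type A (\<tau> s q) = cycle_type A s})
        = real (card (intertwiners A s s)) * three_cycle_weight n (cycle_type A s)"
      using card_three_cycles_preserving_cycle_type[of s A] s fin by (simp add: S_def cardA)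
  qed
  \<comment> \<open>The weight depends only on the cycle type, and on each type the centraliser
    orders add up to n!.\<close>
  also have "\<dots> = (\<Sum>M\<in>partitions_of n. \<Sum>s | s \<in> S \<and> cycle_type A s = M.
      real (card (intertwiners A s s)) * three_cycle_weight n (cycle_type A s))"
    using cycle_type_partitions_of[OF _ fin] cardA
    by (intro sum.group[symmetric] finS finite_partitions_of) (auto simp: S_def)
  also have "\<dots> = (\<Sum>M\<in>partitions_of n. real (fact n) * three_cycle_weight n M)"
  proof (rule sum.cong[OF refl])
    fix M assume M: "M \<in> partitions_of n"
    have "(\<Sum>s | s \<in> S \<and> cycle_type A s = M. real (card (intertwiners A s s)) * three_cycle_weight n (cycle_type A s))
        = (\<Sum>s | s \<in> S \<and> cycle_type A s = M. real (card (intertwiners A s s))) * three_cycle_weight n M"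
      unfolding sum_distrib_right by (rule sum.cong) auto
    also have "(\<Sum>s | s \<in> S \<and> cycle_type A s = M. real (card (intertwiners A s s))) = real (fact n)"
      using sum_card_centralizers[OF fin, of M] M cardA by (simp add: S_def flip: of_nat_sum)
    finally show "(\<Sum>s | s \<in> S \<and> cycle_type A s = M.
        real (card (intertwiners A s s)) * three_cycle_weight n (cycle_type A s)) = real (fact n) * three_cycle_weight n M" .
  qed
  also have "\<dots> = real (fact n) * (\<Sum>M\<in>partitions_of n. three_cycle_weight n M)"
    by (rule sum_distrib_left[symmetric])
  \<comment> \<open>Dividing by the three representations turns 9/8 into 3/8.\<close>
  finally have "real (card B) = 3 / 8 * ((\<Sum>k = 1..n. real (divisor_sigma 3 k) * real (partition_count (n - k)))
                    - 2 * (\<Sum>k = 1..n. real k * real (divisor_sigma 1 k) * real (partition_count (n - k)))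
                    + real n * real (partition_count n)) * real (fact n)"
    unfolding sum_three_cycle_weight by (simp only: mult.commute[of "real (fact n)"])
  thus ?thesis unfolding B_def A_def .
qed

end
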